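(* Assume that $d\ge3$, that $q_0^2=0\le q_1^2\le\dots\le q_T^2$ (with $q_t\ge0$) and that $\sigma_0^2\ge\sigma_1^2\ge\dots\ge\sigma_T^2$; let $\boldsymbol q=(q_1,\dots,q_T)$ and $\boldsymbol\Gamma=(\sigma_0^2,\dots,\sigma_T^2)$. Let $$\mathcal T_{\mathrm{w.o.}}=\Big\{t\in\{1,\dots,T\}:\ q_t^2\le\frac{d\sigma_0^2}{N}\Big\}.$$ Let $t_{\mathrm{w.o.}}$ be the weak-oracle index: $t_{\mathrm{w.o.}}=0$ if $\mathcal T_{\mathrm{w.o.}}=\emptyset$, and otherwise $t_{\mathrm{w.o.}}$ is the index of minimal $\sigma_t^2$ in $\mathcal T_{\mathrm{w.o.}}$, with largest $q_t$ among the minimizers (under the orderings above, the largest index in $\mathcal T_{\mathrm{w.o.}}$). Let $q_{\mathrm{w.o.}}=q_{t_{\mathrm{w.o.}}}$ and $\sigma_{\mathrm{w.o.}}^2=\sigma_{t_{\mathrm{w.o.}}}^2$. Then there exists $c(d)\ge e^{-5}$, depending only on $d$, such that: (i) if $\frac{d\sigma_{\mathrm{w.o.}}^2}{N}\ge q_{\mathrm{w.o.}}^2$, then $$L_{N,d}(\boldsymbol\Psi_*(q_{\mathrm{w.o.}}),\boldsymbol\Gamma)\ \ge\ L_{N,d}(\boldsymbol\Psi_{=}(\boldsymbol q),\boldsymbol\Gamma)\ \ge\ \frac{c^2(d)}{2}\cdot\frac{d\sigma_{\mathrm{w.o.}}^2}{N};$$ (ii) if $\frac{d\sigma_{\mathrm{w.o.}}^2}{N}<q_{\mathrm{w.o.}}^2$,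 then $$L_{N,d}(\boldsymbol\Psi_*(q_{\mathrm{w.o.}}),\boldsymbol\Gamma)\ \ge\ \frac{c^2(d)}{8}\cdot q_{\mathrm{w.o.}}^2.$$
   Context: Curriculum learning (CL) mean-estimation problem with $T\ge1$ sources, dimension $d$ and sample budget $N\ge1$: for an instance $\boldsymbol\theta=(\theta_0,\theta_1,\dots,\theta_T)\in(\mathbb{R}^d)^{T+1}$ and noise variances $\sigma_t^2\in\mathbb{R}_+$, let $\{Z_{i,t}\}_{i\in\{1,\dots,N\},\,t\in\{0,\dots,T\}}$ be independent with $Z_{i,t}\sim\mathcal N(\theta_t,\sigma_t^2I_d)$. A CL algorithm $\mathcal A=(\pi,\hat\theta)$ adaptively chooses at step $i=1,\dots,N$ a model index $A_i\in\{0,\dots,T\}$ (possibly at random) according to a conditional distribution given only the history $(A_1,S_1,\dots,A_{i-1},S_{i-1})$, observes $S_i=Z_{i,A_i}$, and finally outputs an estimate $\hat\theta\in\mathbb{R}^d$ of $\theta_0$ that is a (possibly randomized) measurable function of $(A_i,S_i)_{i=1}^N$. The variances $\boldsymbol\Gamma$ are known to the algorithm. For $\boldsymbol\Psi\subseteq(\mathbb{R}^d)^{T+1}$ the minimax risk is $$L_{N,d}(\boldsymbol\Psi,\boldsymbol\Gamma):=\inf_{\mathcal A}\sup_{\boldsymbol\theta\in\boldsymbol\Psi}\mathbb{E}\big[\|\hat\theta-\theta_0\|^2\big].$$ The fully localized set is $$\boldsymbol\Psi_{=}(\boldsymbol q):=\bigcup_{\zeta}\big\{\boldsymbol\theta\in(\mathbb{R}^d)^{T+1}:\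 \|\theta_t-\theta_0\|^2= q_{\zeta(t)}^2\ \text{for all }t\in\{1,\dots,T\}\big\},$$ and the single localized-source set is $$\boldsymbol\Psi_*(q):=\bigcup_{\zeta}\big\{\boldsymbol\theta\in(\mathbb{R}^d)^{T+1}:\ \exists\,t\in\{1,\dots,T\}\text{ such that }\|\theta_t-\theta_0\|^2=q^2\big\},$$ the unions being over all permutations $\zeta$ of $\{1,\dots,T\}$ (in the second definition the set does not depend on $\zeta$, so the union is redundant).
   Formalization: In (i), the first inequality L(Ψ_*(q_w.o.)) ≥ L(Ψ_=(q)) is asserted only when T_w.o. is nonempty; for T_w.o. = ∅ it is false in general (e.g. T=N=1, q_1² > dσ_0², σ_1 very small). The second inequality of (i) and all of (ii) are kept without restriction. *)

theory Defs
  imports "HOL-Probability.Probability"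
begin

section \<open>Isotropic Gaussians\<close>

text \<open>
  \<open>isotropic_gaussian \<mu> v\<close> is \<open>N(\<mu>, v I\<^sub>d)\<close>, where \<open>v\<close> is the \<^emph>\<open>variance\<close> and \<open>d = DIM('a)\<close>. It is
  the affine image of a standard Gaussian, so that \<open>v = 0\<close> gives the point mass at \<open>\<mu>\<close>
  (\<^const>\<open>normal_density\<close> is junk there).
\<close>

definition isotropic_gaussian :: "'a::euclidean_space \<Rightarrow> real \<Rightarrow> 'a measure" where
  "isotropic_gaussian \<mu> v =
     distr (density lborel (\<lambda>z. \<Prod>b\<in>Basis. ennreal (std_normal_density (z \<bullet> b)))) borel
       (\<lambda>z. \<mu> + sqrt v *\<^sub>R z)"

lemma prob_space_std_gaussian:
  "prob_space (density lborel (\<lambda>z::'a::euclidean_space. \<Prod>b\<in>Basis. ennreal (std_normal_density (z \<bullet> b))))"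
proof
  interpret product_sigma_finite "\<lambda>_::'a. lborel :: real measure" ..
  have one: "(\<integral>\<^sup>+x. ennreal (std_normal_density x) \<partial>lborel) = 1"
    using prob_space.emeasure_space_1[OF prob_space_normal_density[of 1 0]]
    by (simp add: emeasure_density)
  have "(\<integral>\<^sup>+z. (\<Prod>b\<in>Basis. ennreal (std_normal_density ((z::'a) \<bullet> b))) \<partial>lborel) =
        (\<integral>\<^sup>+f. (\<Prod>b\<in>Basis. ennreal (std_normal_density (f b))) \<partial>(\<Pi>\<^sub>M b\<in>(Basis::'a set). lborel))"
    by (subst lborel_eq, subst nn_integral_distr)
       (auto intro!: nn_integral_cong prod.cong simp: inner_sum_left inner_Basis if_distrib sum.delta cong: if_cong)
  also have "\<dots> = (\<Prod>b\<in>(Basis::'a set). \<integral>\<^sup>+x. ennreal (std_normal_density x) \<partial>lborel)"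
    by (rule product_nn_integral_prod) auto
  finally show "emeasure (density lborel (\<lambda>z::'a. \<Prod>b\<in>Basis. ennreal (std_normal_density (z \<bullet> b))))
      (space (density lborel (\<lambda>z::'a. \<Prod>b\<in>Basis. ennreal (std_normal_density (z \<bullet> b))))) = 1"
    by (simp add: emeasure_density one)
qed

lemma prob_space_isotropic_gaussian: "prob_space (isotropic_gaussian \<mu> v)"
  unfolding isotropic_gaussian_def
  by (intro prob_space.prob_space_distr prob_space_std_gaussian) simp

lemma sets_isotropic_gaussian [simp, measurable_cong]: "sets (isotropic_gaussian \<mu> v) = sets borel"
  by (simp add: isotropic_gaussian_def)

lemma isotropic_gaussian_0: "isotropic_gaussian \<mu> 0 = return borel \<mu>"
proof -
  interpret prob_space "density lborel (\<lambda>z::'a. \<Prod>b\<in>Basis. ennreal (std_normal_density (z \<bullet> b)))"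
    by (rule prob_space_std_gaussian)
  show ?thesis
    unfolding isotropic_gaussian_def
    using distr_const[of \<mu> borel] by simp
qed

section \<open>Curriculum learning algorithms and their risk\<close>

text \<open>
  Steps are numbered \<open>0, \<dots>, N - 1\<close>. The history before step \<open>i\<close> is an extensional function on
  \<open>{0..<i}\<close> whose value at \<open>j\<close> is the pair \<open>(A\<^sub>j, S\<^sub>j)\<close>.
\<close>

definition obs_space :: "nat \<Rightarrow> (nat \<times> 'a::euclidean_space) measure" where
  "obs_space T = count_space {0..T} \<Otimes>\<^sub>M borel"

definition hist_space :: "nat \<Rightarrow> nat \<Rightarrow> (nat \<Rightarrow> nat \<times> 'a::euclidean_space) measure" where
  "hist_space T i = (\<Pi>\<^sub>M j\<in>{0..<i}. obs_space T)"

type_synonym 'a policy = "nat \<Rightarrow> (nat \<Rightarrow> nat \<times> 'a) \<Rightarrow> nat measure"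

type_synonym 'a estimator = "(nat \<Rightarrow> nat \<times> 'a) \<Rightarrow> 'a measure"

text \<open>
  Both components are Markov kernels: \<open>\<pi> i\<close> is the conditional distribution of the model index
  chosen at step \<open>i\<close> given the history, and a randomized estimator is the conditional distribution
  of its output given the complete history.
\<close>

definition cl_algorithms :: "nat \<Rightarrow> nat \<Rightarrow> ('a::euclidean_space policy \<times> 'a estimator) set" where
  "cl_algorithms T N = {(\<pi>, est).
     (\<forall>i<N. \<pi> i \<in> hist_space T i \<rightarrow>\<^sub>M prob_algebra (count_space {0..T})) \<and>
     est \<in> hist_space T N \<rightarrow>\<^sub>M prob_algebra borel}"

text \<open>The joint law of the independent family \<open>Z\<^sub>i\<^sub>,\<^sub>t\<close>; \<open>\<Gamma> t\<close> is the variance of model \<open>t\<close>.\<close>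

definition sample_table ::
  "nat \<Rightarrow> nat \<Rightarrow> (nat \<Rightarrow> 'a::euclidean_space) \<Rightarrow> (nat \<Rightarrow> real) \<Rightarrow> (nat \<times> nat \<Rightarrow> 'a) measure" where
  "sample_table T N \<theta> \<Gamma> =
     (\<Pi>\<^sub>M (i, t)\<in>{0..<N} \<times> {0..T}. isotropic_gaussian (\<theta> t) (\<Gamma> t))"

text \<open>Conditional law of the history before step \<open>i\<close>, given the whole table \<open>Z\<close>.\<close>

primrec history_law ::
  "nat \<Rightarrow> 'a::euclidean_space policy \<Rightarrow> (nat \<times> nat \<Rightarrow> 'a) \<Rightarrow> nat \<Rightarrow> (nat \<Rightarrow> nat \<times> 'a) measure" where
  "history_law T \<pi> Z 0 = return (hist_space T 0) (\<lambda>_. undefined)"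
| "history_law T \<pi> Z (Suc i) =
     history_law T \<pi> Z i \<bind>
       (\<lambda>h. distr (\<pi> i h) (hist_space T (Suc i)) (\<lambda>a. h(i := (a, Z (i, a)))))"

definition output_law ::
  "nat \<Rightarrow> nat \<Rightarrow> 'a::euclidean_space policy \<Rightarrow> 'a estimator \<Rightarrow> (nat \<Rightarrow> 'a) \<Rightarrow> (nat \<Rightarrow> real) \<Rightarrow> 'a measure"
where
  "output_law T N \<pi> est \<theta> \<Gamma> = sample_table T N \<theta> \<Gamma> \<bind> (\<lambda>Z. history_law T \<pi> Z N \<bind> est)"

definition risk ::
  "nat \<Rightarrow> nat \<Rightarrow> 'a::euclidean_space policy \<Rightarrow> 'a estimator \<Rightarrow> (nat \<Rightarrow> 'a) \<Rightarrow> (nat \<Rightarrow> real) \<Rightarrow> ennreal"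
where
  "risk T N \<pi> est \<theta> \<Gamma> = (\<integral>\<^sup>+x. ennreal ((norm (x - \<theta> 0))\<^sup>2) \<partial>output_law T N \<pi> est \<theta> \<Gamma>)"

definition minimax_risk ::
  "nat \<Rightarrow> nat \<Rightarrow> (nat \<Rightarrow> 'a::euclidean_space) set \<Rightarrow> (nat \<Rightarrow> real) \<Rightarrow> ennreal" where
  "minimax_risk T N \<Psi> \<Gamma> =
     (INF (\<pi>, est)\<in>cl_algorithms T N. SUP \<theta>\<in>\<Psi>. risk T N \<pi> est \<theta> \<Gamma>)"

subsection \<open>Well-definedness\<close>

lemma space_hist_space_0: "space (hist_space T 0) = {\<lambda>_. undefined}"
  by (simp add: hist_space_def space_PiM)

lemma sets_sample_table:
  "sets (sample_table T N \<theta> \<Gamma>) = sets (\<Pi>\<^sub>M p\<in>{0..<N} \<times> {0..T}. borel)"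
  unfolding sample_table_def by (intro sets_PiM_cong) auto

lemma prob_space_sample_table: "prob_space (sample_table T N \<theta> \<Gamma>)"
  unfolding sample_table_def
  by (intro prob_space_PiM) (auto simp: prob_space_isotropic_gaussian split: prod.splits)

lemma measurable_history_step:
  assumes "i < N"
  shows "(\<lambda>((Z, h), a). h(i := (a, Z (i, a)))) \<in>
    ((\<Pi>\<^sub>M p\<in>{0..<N} \<times> {0..T}. (borel :: 'a::euclidean_space measure)) \<Otimes>\<^sub>M hist_space T i)
      \<Otimes>\<^sub>M count_space {0..T} \<rightarrow>\<^sub>M hist_space T (Suc i)"
    (is "_ \<in> ?S \<rightarrow>\<^sub>M _")
proof -
  have Z: "(\<lambda>w. fst (fst w) (i, snd w)) \<in> ?S \<rightarrow>\<^sub>M (borel :: 'a measure)"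
  proof (rule measurable_compose_countable'[where f = "\<lambda>a w. fst (fst w) (i, a)" and I = "{0..T}" and g = snd])
    fix a assume "a \<in> {0..T}"
    then have "(i, a) \<in> {0..<N} \<times> {0..T}" using assms by auto
    then show "(\<lambda>w. fst (fst w) (i, a)) \<in> ?S \<rightarrow>\<^sub>M (borel :: 'a measure)"
      by (rule measurable_compose[OF measurable_compose[OF measurable_fst measurable_fst]
            measurable_component_singleton])
  qed auto
  have "(\<lambda>w. (snd (fst w))(i := (snd w, fst (fst w) (i, snd w)))) \<in> ?S \<rightarrow>\<^sub>M hist_space T (Suc i)"
    unfolding hist_space_def
  proof (rule measurable_fun_upd[where J = "{0..<i}"])
    show "{0..<Suc i} = {0..<i} \<union> {i}" by auto
    show "(\<lambda>w. (snd w, fst (fst w) (i, snd w))) \<in>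
        ((\<Pi>\<^sub>M p\<in>{0..<N} \<times> {0..T}. borel) \<Otimes>\<^sub>M (\<Pi>\<^sub>M j\<in>{0..<i}. (obs_space T :: (nat \<times> 'a) measure)))
          \<Otimes>\<^sub>M count_space {0..T} \<rightarrow>\<^sub>M (obs_space T :: (nat \<times> 'a) measure)"
      using Z unfolding obs_space_def hist_space_def by (intro measurable_Pair) auto
  qed auto
  then show ?thesis by (simp add: split_beta')
qed

lemma history_law_kernel:
  fixes \<pi> :: "'a::euclidean_space policy"
  assumes \<pi>: "\<And>i. i < N \<Longrightarrow> \<pi> i \<in> hist_space T i \<rightarrow>\<^sub>M prob_algebra (count_space {0..T})"
  shows "i \<le> N \<Longrightarrow> (\<lambda>Z. history_law T \<pi> Z i) \<in>
    (\<Pi>\<^sub>M p\<in>{0..<N} \<times> {0..T}. borel) \<rightarrow>\<^sub>M prob_algebra (hist_space T i)"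
proof (induction i)
  case 0
  have "return (hist_space T 0) (\<lambda>_. undefined)
      \<in> space (prob_algebra (hist_space T 0 :: (nat \<Rightarrow> nat \<times> 'a) measure))"
    by (simp add: space_prob_algebra prob_space_return space_hist_space_0)
  then show ?case by (simp add: measurable_const)
next
  case (Suc i)
  let ?S = "\<Pi>\<^sub>M p\<in>{0..<N} \<times> {0..T}. (borel :: 'a measure)"
  have IH: "(\<lambda>Z. history_law T \<pi> Z i) \<in> ?S \<rightarrow>\<^sub>M prob_algebra (hist_space T i)"
    using Suc by simp
  have \<pi>i: "(\<lambda>w. \<pi> i (snd w)) \<in> ?S \<Otimes>\<^sub>M hist_space T i \<rightarrow>\<^sub>M prob_algebra (count_space {0..T})"
    using \<pi>[of i] Suc.prems by (intro measurable_compose[OF measurable_snd]) auto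
  have "(\<lambda>w. distr (\<pi> i (snd w)) (hist_space T (Suc i)) (\<lambda>a. (snd w)(i := (a, fst w (i, a))))) \<in>
      ?S \<Otimes>\<^sub>M hist_space T i \<rightarrow>\<^sub>M prob_algebra (hist_space T (Suc i))"
    using measurable_history_step[of i N T] Suc.prems
    by (intro measurable_distr_prob_space2[OF \<pi>i]) (simp add: split_beta')
  then show ?case
    by (simp add: split_beta' measurable_bind_prob_space2[OF IH])
qed

lemma output_law_in_prob_algebra:
  fixes \<pi> :: "'a::euclidean_space policy"
  assumes "(\<pi>, est) \<in> cl_algorithms T N"
  shows "output_law T N \<pi> est \<theta> \<Gamma> \<in> space (prob_algebra borel)"
proof -
  have "(\<lambda>Z. history_law T \<pi> Z N) \<in> (\<Pi>\<^sub>M p\<in>{0..<N} \<times> {0..T}. borel) \<rightarrow>\<^sub>M prob_algebra (hist_space T N)"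
    using assms by (intro history_law_kernel) (auto simp: cl_algorithms_def)
  then have K: "(\<lambda>Z. history_law T \<pi> Z N \<bind> est) \<in>
      (\<Pi>\<^sub>M p\<in>{0..<N} \<times> {0..T}. borel) \<rightarrow>\<^sub>M prob_algebra borel"
    using assms by (intro measurable_bind_prob_space[where N = "hist_space T N"]) (auto simp: cl_algorithms_def)
  have "sample_table T N \<theta> \<Gamma> \<in> space (prob_algebra (\<Pi>\<^sub>M p\<in>{0..<N} \<times> {0..T}. borel))"
    by (simp add: space_prob_algebra sets_sample_table prob_space_sample_table)
  then show ?thesis
    unfolding output_law_def
    by (simp add: space_prob_algebra prob_space_bind'[OF _ K] sets_bind'[OF _ K])
qed

section \<open>Localized sets and the weak oracle\<close>

definition Psi_eq :: "nat \<Rightarrow> (nat \<Rightarrow> real) \<Rightarrow> (nat \<Rightarrow> 'a::euclidean_space) set" where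
  "Psi_eq T q = (\<Union>\<zeta>\<in>{\<zeta>. \<zeta> permutes {1..T}}.
     {\<theta> \<in> {0..T} \<rightarrow>\<^sub>E UNIV. \<forall>t\<in>{1..T}. (norm (\<theta> t - \<theta> 0))\<^sup>2 = (q (\<zeta> t))\<^sup>2})"

definition Psi_star :: "nat \<Rightarrow> real \<Rightarrow> (nat \<Rightarrow> 'a::euclidean_space) set" where
  "Psi_star T r = (\<Union>\<zeta>\<in>{\<zeta>. \<zeta> permutes {1..T}}.
     {\<theta> \<in> {0..T} \<rightarrow>\<^sub>E UNIV. \<exists>t\<in>{1..T}. (norm (\<theta> t - \<theta> 0))\<^sup>2 = r\<^sup>2})"

text \<open>
  A pitfall: if there is no weak oracle source, the oracle index is \<open>0\<close> and \<open>q 0 = 0\<close> is the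
  radius of the target, not that of a source. Then \<open>Psi_star T 0\<close> does not contain \<open>Psi_eq T q\<close>
  (it forces some source to coincide with the target) and the comparison of their minimax risks
  fails: in the following example \<open>Psi_star 1 0\<close> has minimax risk \<open>0\<close>, whereas the claimed lower
  bound is a positive multiple of \<open>\<Gamma> 0\<close> when \<open>0 < DIM('a) * \<Gamma> 0 < (q 1)\<^sup>2\<close>. The comparison is
  therefore only made if a weak oracle source exists.
\<close>

lemma minimax_risk_Psi_star_0:
  assumes "\<Gamma> 1 = 0"
  shows "minimax_risk 1 1 (Psi_star 1 0 :: (nat \<Rightarrow> 'a::euclidean_space) set) \<Gamma> = 0"
proof -
  define \<pi> :: "'a policy" where "\<pi> = (\<lambda>_ _. return (count_space {0..1}) 1)"
  define est :: "'a estimator" where "est = (\<lambda>h. return borel (snd (h 0)))"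
  have "return (count_space {0..1}) 1 \<in> space (prob_algebra (count_space {0..1::nat}))"
    by (simp add: space_prob_algebra prob_space_return)
  then have \<pi>: "\<pi> i \<in> hist_space 1 i \<rightarrow>\<^sub>M prob_algebra (count_space {0..1})" for i
    unfolding \<pi>_def by (rule measurable_const)
  have est0: "(\<lambda>h. snd (h 0)) \<in> hist_space 1 1 \<rightarrow>\<^sub>M (borel :: 'a measure)"
  proof -
    have "(\<lambda>h. h 0) \<in> hist_space 1 1 \<rightarrow>\<^sub>M (obs_space 1 :: (nat \<times> 'a) measure)"
      unfolding hist_space_def by (rule measurable_component_singleton) simp
    then show ?thesis
      unfolding obs_space_def by (rule measurable_compose[OF _ measurable_snd])
  qed
  have est: "est \<in> hist_space 1 1 \<rightarrow>\<^sub>M prob_algebra borel"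
    unfolding est_def by (rule measurable_compose[OF est0 measurable_return_prob_space])
  have alg: "(\<pi>, est) \<in> cl_algorithms 1 1"
    using \<pi> est by (simp add: cl_algorithms_def)
  have "risk 1 1 \<pi> est \<theta> \<Gamma> = 0" if "\<theta> \<in> Psi_star 1 0" for \<theta> :: "nat \<Rightarrow> 'a"
  proof -
    have eq: "\<theta> 1 = \<theta> 0" using that by (auto simp: Psi_star_def)
    let ?M = "sample_table 1 1 \<theta> \<Gamma>"
    let ?h = "\<lambda>Z a. (\<lambda>_. undefined)(0 := (a, Z (0, a))) :: nat \<Rightarrow> nat \<times> 'a"
    have hist: "history_law 1 \<pi> Z 1 \<bind> est = return borel (Z (0, 1))" for Z
    proof -
      have h: "?h Z a \<in> space (hist_space 1 1)" if "a \<in> {0..1}" for a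
        using that by (auto simp: hist_space_def obs_space_def space_PiM space_pair_measure PiE_def extensional_def)
      have "(\<lambda>h. distr (\<pi> 0 h) (hist_space 1 1) (\<lambda>a. h(0 := (a, Z (0, a)))))
          \<in> hist_space 1 0 \<rightarrow>\<^sub>M subprob_algebra (hist_space 1 1)"
      proof (rule measurable_subprob_algebra)
        fix h :: "nat \<Rightarrow> nat \<times> 'a" assume "h \<in> space (hist_space 1 0)"
        then have "h = (\<lambda>_. undefined)" by (simp add: space_hist_space_0)
        then show "subprob_space (distr (\<pi> 0 h) (hist_space 1 1) (\<lambda>a. h(0 := (a, Z (0, a)))))"
          using h by (intro prob_space_imp_subprob_space prob_space.prob_space_distr)
            (auto simp: \<pi>_def prob_space_return)
      next
        have "sets (hist_space 1 0 :: (nat \<Rightarrow> nat \<times> 'a) measure) = {{}, {\<lambda>_. undefined}}"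
          by (simp add: hist_space_def sets_PiM_empty)
        then have "f \<in> borel_measurable (hist_space 1 0)"
          for f :: "(nat \<Rightarrow> nat \<times> 'a) \<Rightarrow> ennreal"
          by (auto simp: measurable_def space_hist_space_0)
        then show "(\<lambda>h. emeasure (distr (\<pi> 0 h) (hist_space 1 1) (\<lambda>a. h(0 := (a, Z (0, a))))) A)
            \<in> borel_measurable (hist_space 1 0)" for A .
      qed simp
      then have "history_law 1 \<pi> Z 1 = distr (\<pi> 0 (\<lambda>_. undefined)) (hist_space 1 1) (?h Z)"
        by (simp add: bind_return[where N = "hist_space 1 1"] space_hist_space_0)
      also have "\<dots> = return (hist_space 1 1) (?h Z 1)"
        unfolding \<pi>_def using h by (intro distr_return) auto
      finally show ?thesis
        using bind_return[OF measurable_prob_algebraD[OF est] h[of 1]] by (simp add: est_def)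
    qed
    have comp: "(\<lambda>Z. Z (0, 1)) \<in> ?M \<rightarrow>\<^sub>M borel"
      unfolding measurable_cong_sets[OF sets_sample_table refl]
      by (rule measurable_component_singleton) simp
    have "output_law 1 1 \<pi> est \<theta> \<Gamma> = distr ?M borel (\<lambda>Z. Z (0, 1))"
      unfolding output_law_def hist
      using prob_space.not_empty[OF prob_space_sample_table] comp
      by (rule bind_return_distr')
    also have "\<dots> = distr ?M (isotropic_gaussian (\<theta> 1) (\<Gamma> 1)) (\<lambda>Z. Z (0, 1))"
      by (intro distr_cong) simp_all
    also have "\<dots> = return borel (\<theta> 0)"
    proof -
      interpret product_prob_space
        "\<lambda>(i::nat, t). isotropic_gaussian (\<theta> t) (\<Gamma> t)" "{0..<1} \<times> {0..1}"
        by (intro product_prob_spaceI) (auto simp: prob_space_isotropic_gaussian)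
      show ?thesis
        using PiM_component[of "(0, 1)"] assms eq
        by (simp add: sample_table_def isotropic_gaussian_0)
    qed
    finally show ?thesis by (simp add: risk_def nn_integral_return)
  qed
  then have "(SUP \<theta>\<in>(Psi_star 1 0 :: (nat \<Rightarrow> 'a) set). risk 1 1 \<pi> est \<theta> \<Gamma>) \<le> 0"
    by (intro SUP_least) simp
  moreover have "minimax_risk 1 1 (Psi_star 1 0 :: (nat \<Rightarrow> 'a) set) \<Gamma>
      \<le> (SUP \<theta>\<in>(Psi_star 1 0 :: (nat \<Rightarrow> 'a) set). risk 1 1 \<pi> est \<theta> \<Gamma>)"
    unfolding minimax_risk_def by (rule INF_lower2[OF alg]) simp
  ultimately show ?thesis by simp
qed

definition weak_oracle_set :: "nat \<Rightarrow> nat \<Rightarrow> nat \<Rightarrow> (nat \<Rightarrow> real) \<Rightarrow> (nat \<Rightarrow> real) \<Rightarrow> nat set" where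
  "weak_oracle_set d T N q \<Gamma> = {t \<in> {1..T}. (q t)\<^sup>2 \<le> real d * \<Gamma> 0 / real N}"

text \<open>
  Indices tied in both variance and radius are interchangeable below; the largest one is taken.
\<close>

definition weak_oracle :: "nat \<Rightarrow> nat \<Rightarrow> nat \<Rightarrow> (nat \<Rightarrow> real) \<Rightarrow> (nat \<Rightarrow> real) \<Rightarrow> nat" where
  "weak_oracle d T N q \<Gamma> =
     (let W = weak_oracle_set d T N q \<Gamma> in
      if W = {} then 0
      else Max {t \<in> W. (\<forall>s\<in>W. \<Gamma> t \<le> \<Gamma> s) \<and> (\<forall>s\<in>W. \<Gamma> s = \<Gamma> t \<longrightarrow> q s \<le> q t)})"

lemma weak_oracle_eq_Max:
  assumes W: "weak_oracle_set d T N q \<Gamma> \<noteq> {}"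
    and q: "\<And>s t. 1 \<le> s \<Longrightarrow> s \<le> t \<Longrightarrow> t \<le> T \<Longrightarrow> q s \<le> q t"
    and \<Gamma>: "\<And>s t. s \<le> t \<Longrightarrow> t \<le> T \<Longrightarrow> \<Gamma> t \<le> \<Gamma> s"
  shows "weak_oracle d T N q \<Gamma> = Max (weak_oracle_set d T N q \<Gamma>)"
proof -
  define W where "W = weak_oracle_set d T N q \<Gamma>"
  have fin: "finite W" and ne: "W \<noteq> {}" using W by (auto simp: W_def weak_oracle_set_def)
  have sub: "W \<subseteq> {1..T}" by (auto simp: W_def weak_oracle_set_def)
  let ?V = "{t \<in> W. (\<forall>s\<in>W. \<Gamma> t \<le> \<Gamma> s) \<and> (\<forall>s\<in>W. \<Gamma> s = \<Gamma> t \<longrightarrow> q s \<le> q t)}"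
  have max: "Max W \<in> W" "\<And>s. s \<in> W \<Longrightarrow> s \<le> Max W" using fin ne by auto
  then have "Max W \<in> ?V" using sub q \<Gamma> by (auto simp: subset_iff)
  then have "Max ?V = Max W" using fin max by (intro Max_eqI) auto
  then show ?thesis using ne by (simp add: weak_oracle_def W_def[symmetric] Let_def)
qed

end

theory Submission
  imports Defs
begin

text \<open>
  Both bounds are instances of Assouad's lemma. The target \<open>\<theta> 0\<close> runs over a hypercube whose side is of
  the order of the noise level per coordinate after \<open>N\<close> samples. A set \<open>I\<close> of informative models, all of
  variance at least \<open>s\<close>, is translated together with \<open>\<theta> 0\<close>, while the means of the others do not depend
  on the vertex; these may have arbitrarily small variance, since the distance constraints still allow
  their means to be equidistant from all vertices. In (i) a source outside \<open>I\<close> sits on an axis orthogonal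
  to the hypercube, which is possible because its radius exceeds the circumradius of the hypercube; in (ii)
  all sources sit at the centre, and the circumradius is \<open>q\<^sub>w\<^sub>o\<close>.

  Adaptivity is harmless: under two vertices that differ in one coordinate by \<open>2 \<delta>\<close>, the likelihood
  ratios \<open>l, l'\<close> of the history with respect to the midpoint satisfy \<open>l l' \<ge> exp (- N \<delta>\<^sup>2 / s)\<close>
  pointwise, whatever models were sampled, and \<open>l, l'\<close> have mean \<open>1\<close>. This bounds the sum of the two
  coordinate risks from below by \<open>2 \<delta>\<^sup>2 / e\<close>, so that \<open>c(d) = exp (- 5)\<close> is attained with room to spare.
\<close>

section \<open>Translation of Gaussians\<close>

lemma std_normal_density_add:
  "std_normal_density (k + x) * exp (k * (k + x) - k\<^sup>2 / 2) = std_normal_density x"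
  by (simp add: std_normal_density_def mult_exp_exp power2_eq_square field_simps)

text \<open>The Cameron-Martin formula for a shift of the mean. In standardised coordinates the
  shift is a translation of Lebesgue measure, and the density factorises over the basis into
  instances of \<open>std_normal_density_add\<close>. Positive variance matters: distinct point
  masses have no density with respect to each other.\<close>

lemma isotropic_gaussian_add:
  fixes m u :: "'a::euclidean_space"
  assumes "v > 0"
  shows "isotropic_gaussian (m + u) v =
    density (isotropic_gaussian m v) (\<lambda>s. ennreal (exp ((s - m) \<bullet> u / v - u \<bullet> u / (2 * v))))"
    (is "_ = density _ ?r")
proof (rule measure_eqI)
  fix A assume "A \<in> sets (isotropic_gaussian (m + u) v)"
  then have A[measurable]: "A \<in> sets borel" by simp
  define g :: "'a \<Rightarrow> ennreal" where "g z = (\<Prod>b\<in>Basis. ennreal (std_normal_density (z \<bullet> b)))" for z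
  have g[measurable]: "g \<in> borel_measurable borel" unfolding g_def by measurable
  have ig: "isotropic_gaussian m' v = distr (density lborel g) borel (\<lambda>z. m' + sqrt v *\<^sub>R z)" for m' :: 'a
    unfolding isotropic_gaussian_def g_def ..
  have E: "(\<integral>\<^sup>+s. f s \<partial>isotropic_gaussian m' v) = (\<integral>\<^sup>+z. g z * f (m' + sqrt v *\<^sub>R z) \<partial>lborel)"
    if [measurable]: "f \<in> borel_measurable borel" for f and m' :: 'a
    unfolding ig by (simp add: nn_integral_distr nn_integral_density)
  \<comment> \<open>Moving the mean by \<open>u\<close> amounts to translating the standard variable
    \<open>z\<close> by \<open>k\<close>, since \<open>sqrt v *\<^sub>R k = u\<close>.\<close>
  define k where "k = u /\<^sub>R sqrt v"
  have key: "g (k + z) * ?r (m + sqrt v *\<^sub>R (k + z)) = g z" for z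
  proof -
    have u: "u = sqrt v *\<^sub>R k" using assms by (simp add: k_def)
    have vv: "(sqrt v *\<^sub>R x) \<bullet> (sqrt v *\<^sub>R y) = v * (x \<bullet> y)" for x y :: 'a
      using real_sqrt_mult_self[of v] assms
      by (simp only: inner_scaleR_left inner_scaleR_right mult.assoc[symmetric] abs_of_pos)
    have "(m + sqrt v *\<^sub>R (k + z) - m) \<bullet> u = v * (k \<bullet> (k + z))"
      by (simp only: add_diff_cancel_left' u vv inner_commute[of "k + z"])
    then have "(m + sqrt v *\<^sub>R (k + z) - m) \<bullet> u / v = k \<bullet> (k + z)"
      using assms by simp
    moreover have "u \<bullet> u / (2 * v) = (k \<bullet> k) / 2"
      using assms by (simp only: u vv) simp
    ultimately have "?r (m + sqrt v *\<^sub>R (k + z)) = ennreal (exp (k \<bullet> (k + z) - (k \<bullet> k) / 2))"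
      by simp
    also have "k \<bullet> (k + z) - (k \<bullet> k) / 2 =
        (\<Sum>b\<in>Basis. (k \<bullet> b) * ((k \<bullet> b) + (z \<bullet> b)) - (k \<bullet> b)\<^sup>2 / 2)"
      unfolding euclidean_inner[of k "k + z"] euclidean_inner[of k k]
      by (simp add: sum_subtractf sum_divide_distrib inner_add_left power2_eq_square)
    also have "ennreal (exp \<dots>) =
        (\<Prod>b\<in>Basis. ennreal (exp ((k \<bullet> b) * ((k \<bullet> b) + (z \<bullet> b)) - (k \<bullet> b)\<^sup>2 / 2)))"
      by (simp add: exp_sum prod_ennreal)
    finally show ?thesis
      by (simp add: g_def prod.distrib[symmetric] inner_add_left ennreal_mult[symmetric] std_normal_density_add)
  qed
  have "emeasure (isotropic_gaussian (m + u) v) A = (\<integral>\<^sup>+z. g z * indicator A (m + u + sqrt v *\<^sub>R z) \<partial>lborel)"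
    using E[of "indicator A" "m + u"] by (simp add: nn_integral_indicator)
  also have "\<dots> = (\<integral>\<^sup>+z. g (k + z) * (?r (m + sqrt v *\<^sub>R (k + z)) * indicator A (m + sqrt v *\<^sub>R (k + z))) \<partial>lborel)"
  proof (rule nn_integral_cong)
    fix z
    have "m + sqrt v *\<^sub>R (k + z) = m + u + sqrt v *\<^sub>R z"
      using assms by (simp add: k_def scaleR_add_right)
    then show "g z * indicator A (m + u + sqrt v *\<^sub>R z) =
        g (k + z) * (?r (m + sqrt v *\<^sub>R (k + z)) * indicator A (m + sqrt v *\<^sub>R (k + z)))"
      using key[of z] by (simp add: add.assoc flip: mult.assoc)
  qed
  \<comment> \<open>Writing the translate as a pushforward of Lebesgue measure lets translation
    invariance remove it.\<close>
  also have "\<dots> = (\<integral>\<^sup>+z. g z * (?r (m + sqrt v *\<^sub>R z) * indicator A (m + sqrt v *\<^sub>R z)) \<partial>distr lborel borel ((+) k))"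
    by (subst nn_integral_distr) (simp_all)
  also have "\<dots> = (\<integral>\<^sup>+s. ?r s * indicator A s \<partial>isotropic_gaussian m v)"
    by (subst E) (simp_all add: lborel_distr_plus)
  also have "\<dots> = emeasure (density (isotropic_gaussian m v) ?r) A"
    by (simp add: emeasure_density)
  finally show "emeasure (isotropic_gaussian (m + u) v) A = emeasure (density (isotropic_gaussian m v) ?r) A" .
qed simp

section \<open>The law of the history\<close>

lemma measurable_hist_append:
  assumes f: "f \<in> M \<rightarrow>\<^sub>M hist_space T i"
    and g: "g \<in> M \<rightarrow>\<^sub>M count_space {0..T}"
    and s: "s \<in> M \<rightarrow>\<^sub>M (borel :: 'a::euclidean_space measure)"
  shows "(\<lambda>w. (f w)(i := (g w, s w))) \<in> M \<rightarrow>\<^sub>M hist_space T (Suc i)"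
  unfolding hist_space_def
proof (rule measurable_fun_upd[where J = "{0..<i}"])
  show "{0..<Suc i} = {0..<i} \<union> {i}" by auto
  show "f \<in> M \<rightarrow>\<^sub>M (\<Pi>\<^sub>M j\<in>{0..<i}. obs_space T)" using f by (simp add: hist_space_def)
  show "(\<lambda>w. (g w, s w)) \<in> M \<rightarrow>\<^sub>M obs_space T"
    using g s unfolding obs_space_def by (rule measurable_Pair)
qed

lemma measurable_append_sample:
  assumes "h \<in> space (hist_space T i)" "a \<in> {0..T}"
  shows "(\<lambda>x. h(i := (a, x))) \<in> (borel :: 'a::euclidean_space measure) \<rightarrow>\<^sub>M hist_space T (Suc i)"
  using assms(2) by (intro measurable_hist_append[OF measurable_const[OF assms(1)]]) auto

text \<open>The first \<open>i\<close> steps read only rows before \<open>i\<close>. This is what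
  makes row \<open>i\<close> independent of the history when it is used.\<close>

lemma history_law_cong:
  assumes "\<And>j a. j < i \<Longrightarrow> Z (j, a) = Z' (j, a)"
  shows "history_law T \<pi> Z i = history_law T \<pi> Z' i"
  using assms by (induction i) simp_all

locale cl_algorithm =
  fixes T N :: nat and \<pi> :: "'a::euclidean_space policy" and est :: "'a estimator" and \<Gamma> :: "nat \<Rightarrow> real"
  assumes alg: "(\<pi>, est) \<in> cl_algorithms T N"
begin

lemma measurable_policy [measurable]:
  "i < N \<Longrightarrow> \<pi> i \<in> hist_space T i \<rightarrow>\<^sub>M prob_algebra (count_space {0..T})"
  using alg by (simp add: cl_algorithms_def)

lemma measurable_estimator [measurable]: "est \<in> hist_space T N \<rightarrow>\<^sub>M prob_algebra borel"
  using alg by (simp add: cl_algorithms_def)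

abbreviation tables :: "(nat \<times> nat \<Rightarrow> 'a) measure" where
  "tables \<equiv> \<Pi>\<^sub>M p\<in>{0..<N} \<times> {0..T}. borel"

lemma measurable_history_law:
  "i \<le> N \<Longrightarrow> (\<lambda>Z. history_law T \<pi> Z i) \<in> tables \<rightarrow>\<^sub>M prob_algebra (hist_space T i)"
  using history_law_kernel[of N \<pi> T i] by simp

section \<open>Expectations over histories and their one-step recursion\<close>

text \<open>Kept as an iterated integral over the table and the conditional law of the history, so
  that Fubini can split the table into rows.\<close>

definition hist_expectation ::
  "(nat \<Rightarrow> 'a) \<Rightarrow> nat \<Rightarrow> ((nat \<Rightarrow> nat \<times> 'a) \<Rightarrow> ennreal) \<Rightarrow> ennreal" where
  "hist_expectation \<theta> i F = (\<integral>\<^sup>+Z. \<integral>\<^sup>+h. F h \<partial>history_law T \<pi> Z i \<partial>sample_table T N \<theta> \<Gamma>)"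

text \<open>The one-step conditional expectation given \<open>h\<close>. The sample is drawn afresh
  from the law of the chosen model, without reference to the table.\<close>

definition step_expectation ::
  "(nat \<Rightarrow> 'a) \<Rightarrow> nat \<Rightarrow> ((nat \<Rightarrow> nat \<times> 'a) \<Rightarrow> ennreal) \<Rightarrow> (nat \<Rightarrow> nat \<times> 'a) \<Rightarrow> ennreal" where
  "step_expectation \<theta> i F h =
     (\<integral>\<^sup>+a. \<integral>\<^sup>+s. F (h(i := (a, s))) \<partial>isotropic_gaussian (\<theta> a) (\<Gamma> a) \<partial>\<pi> i h)"

lemma measurable_step_expectation [measurable]:
  assumes i: "i < N" and F[measurable]: "F \<in> borel_measurable (hist_space T (Suc i))"
  shows "step_expectation \<theta> i F \<in> borel_measurable (hist_space T i)"
  unfolding step_expectation_def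
proof (rule nn_integral_measurable_subprob_algebra2[where N = "count_space {0..T}"])
  show "\<pi> i \<in> hist_space T i \<rightarrow>\<^sub>M subprob_algebra (count_space {0..T})"
    using i by (intro measurable_prob_algebraD) simp
  \<comment> \<open>On a discrete index set every family of probability laws is a kernel.\<close>
  have G: "(\<lambda>a. isotropic_gaussian (\<theta> a) (\<Gamma> a)) \<in> count_space {0..T} \<rightarrow>\<^sub>M subprob_algebra borel"
    by (auto simp: space_subprob_algebra prob_space_isotropic_gaussian intro!: prob_space_imp_subprob_space)
  have "(\<lambda>w. (fst (fst w))(i := (snd (fst w), snd w))) \<in>
      (hist_space T i \<Otimes>\<^sub>M count_space {0..T}) \<Otimes>\<^sub>M borel \<rightarrow>\<^sub>M hist_space T (Suc i)"
    by (rule measurable_hist_append[OF measurable_compose[OF measurable_fst measurable_fst]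
        measurable_compose[OF measurable_fst measurable_snd] measurable_snd])
  from measurable_compose[OF this F]
  show "(\<lambda>(h, a). \<integral>\<^sup>+s. F (h(i := (a, s))) \<partial>isotropic_gaussian (\<theta> a) (\<Gamma> a)) \<in>
      borel_measurable (hist_space T i \<Otimes>\<^sub>M count_space {0..T})"
    unfolding case_prod_beta
    by (intro nn_integral_measurable_subprob_algebra2[where N = borel] measurable_compose[OF measurable_snd G])
       (simp add: case_prod_beta')
qed

lemma nn_integral_history_law_Suc:
  assumes i: "i < N" and F[measurable]: "F \<in> borel_measurable (hist_space T (Suc i))"
    and Z: "Z \<in> space tables"
  shows "(\<integral>\<^sup>+h. F h \<partial>history_law T \<pi> Z (Suc i)) =
    (\<integral>\<^sup>+h. \<integral>\<^sup>+a. F (h(i := (a, Z (i, a)))) \<partial>\<pi> i h \<partial>history_law T \<pi> Z i)"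
proof -
  have sets: "sets (history_law T \<pi> Z i) = sets (hist_space T i)"
    using measurable_space[OF measurable_history_law[of i] Z] i by (simp add: space_prob_algebra)
  have \<pi>i: "\<pi> i \<in> hist_space T i \<rightarrow>\<^sub>M prob_algebra (count_space {0..T})" using i by simp
  have app: "(\<lambda>(h, a). h(i := (a, Z (i, a)))) \<in> hist_space T i \<Otimes>\<^sub>M count_space {0..T} \<rightarrow>\<^sub>M hist_space T (Suc i)"
    unfolding case_prod_beta
    by (rule measurable_hist_append[OF measurable_fst measurable_snd measurable_compose[OF measurable_snd]]) simp
  have K: "(\<lambda>h. distr (\<pi> i h) (hist_space T (Suc i)) (\<lambda>a. h(i := (a, Z (i, a)))))
      \<in> hist_space T i \<rightarrow>\<^sub>M subprob_algebra (hist_space T (Suc i))"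
    using app by (intro measurable_prob_algebraD measurable_distr_prob_space2[OF \<pi>i]) simp
  have "(\<integral>\<^sup>+h. F h \<partial>history_law T \<pi> Z (Suc i)) = (\<integral>\<^sup>+h. \<integral>\<^sup>+h'. F h' \<partial>distr (\<pi> i h) (hist_space T (Suc i)) (\<lambda>a. h(i := (a, Z (i, a)))) \<partial>history_law T \<pi> Z i)"
    using K unfolding history_law.simps
    by (intro nn_integral_bind[where B = "hist_space T (Suc i)"])
       (simp_all add: measurable_cong_sets[OF sets refl])
  also have "\<dots> = (\<integral>\<^sup>+h. \<integral>\<^sup>+a. F (h(i := (a, Z (i, a)))) \<partial>\<pi> i h \<partial>history_law T \<pi> Z i)"
  proof (rule nn_integral_cong)
    fix h assume "h \<in> space (history_law T \<pi> Z i)"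
    then have h: "h \<in> space (hist_space T i)" using sets_eq_imp_space_eq[OF sets] by simp
    then have s: "sets (\<pi> i h) = sets (count_space {0..T})"
      using measurable_space[OF \<pi>i h] by (simp add: space_prob_algebra)
    have "(\<lambda>a. h(i := (a, Z (i, a)))) \<in> count_space {0..T} \<rightarrow>\<^sub>M hist_space T (Suc i)"
      using measurable_compose[OF measurable_Pair1'[OF h] app] by simp
    then show "(\<integral>\<^sup>+h'. F h' \<partial>distr (\<pi> i h) (hist_space T (Suc i)) (\<lambda>a. h(i := (a, Z (i, a))))) =
        (\<integral>\<^sup>+a. F (h(i := (a, Z (i, a)))) \<partial>\<pi> i h)"
      by (intro nn_integral_distr) (simp_all add: measurable_cong_sets[OF s refl])
  qed
  finally show ?thesis .
qed

lemma measurable_nn_integral_history_law: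
  assumes "i \<le> N" "F \<in> borel_measurable (hist_space T i)"
  shows "(\<lambda>Z. \<integral>\<^sup>+h. F h \<partial>history_law T \<pi> Z i) \<in> borel_measurable tables"
  using assms
  by (intro measurable_compose[OF measurable_prob_algebraD[OF measurable_history_law]]
      nn_integral_measurable_subprob_algebra) auto

text \<open>The policy chooses \<open>a\<close> from \<open>h\<close> alone, so Fubini allows
  \<open>a\<close> to be fixed before the row is integrated; only the marginal at
  \<open>(i, a)\<close> then remains.\<close>

lemma nn_integral_row:
  fixes \<theta> :: "nat \<Rightarrow> 'a"
  assumes i: "i < N" and F[measurable]: "F \<in> borel_measurable (hist_space T (Suc i))"
    and h: "h \<in> space (hist_space T i)"
  defines "R \<equiv> \<Pi>\<^sub>M p\<in>{i} \<times> {0..T}. isotropic_gaussian (\<theta> (snd p)) (\<Gamma> (snd p))"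
  shows "(\<integral>\<^sup>+y. \<integral>\<^sup>+a. F (h(i := (a, y (i, a)))) \<partial>\<pi> i h \<partial>R) = step_expectation \<theta> i F h"
proof -
  have \<pi>i: "\<pi> i \<in> hist_space T i \<rightarrow>\<^sub>M prob_algebra (count_space {0..T})" using i by simp
  have s: "sets (\<pi> i h) = sets (count_space {0..T})" and p: "prob_space (\<pi> i h)"
    using measurable_space[OF \<pi>i h] by (simp_all add: space_prob_algebra)
  have pR: "prob_space R" unfolding R_def by (intro prob_space_PiM prob_space_isotropic_gaussian)
  have sR: "sets R = sets (\<Pi>\<^sub>M p\<in>{i} \<times> {0..T}. borel)" unfolding R_def by (intro sets_PiM_cong) auto
  have comp: "(\<lambda>y. y (i, a)) \<in> R \<rightarrow>\<^sub>M borel" if "a \<in> {0..T}" for a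
    using that unfolding measurable_cong_sets[OF sR refl]
    by (intro measurable_component_singleton) simp
  \<comment> \<open>Reading the row at a random index is measurable because there are only countably
    many indices.\<close>
  have "(\<lambda>w. snd w (i, fst w)) \<in> count_space {0..T} \<Otimes>\<^sub>M R \<rightarrow>\<^sub>M borel"
    by (rule measurable_compose_countable'[where f = "\<lambda>a w. snd w (i, a)" and I = "{0..T}" and g = fst,
        OF measurable_compose[OF measurable_snd comp]]) auto
  then have "(\<lambda>w. h(i := (fst w, snd w (i, fst w)))) \<in> count_space {0..T} \<Otimes>\<^sub>M R \<rightarrow>\<^sub>M hist_space T (Suc i)"
    by (rule measurable_hist_append[OF measurable_const[OF h] measurable_fst])
  then have "(\<lambda>(a, y). F (h(i := (a, y (i, a))))) \<in> borel_measurable (count_space {0..T} \<Otimes>\<^sub>M R)"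
    unfolding case_prod_beta by (rule measurable_compose[OF _ F])
  then have "(\<lambda>(a, y). F (h(i := (a, y (i, a))))) \<in> borel_measurable (\<pi> i h \<Otimes>\<^sub>M R)"
    by (simp add: measurable_cong_sets[OF sets_pair_measure_cong[OF s refl] refl])
  then have "(\<integral>\<^sup>+y. \<integral>\<^sup>+a. F (h(i := (a, y (i, a)))) \<partial>\<pi> i h \<partial>R) =
      (\<integral>\<^sup>+a. \<integral>\<^sup>+y. F (h(i := (a, y (i, a)))) \<partial>R \<partial>\<pi> i h)"
    by (intro pair_sigma_finite.Fubini' pair_sigma_finite.intro prob_space_imp_sigma_finite p pR)
  also have "\<dots> = step_expectation \<theta> i F h"
    unfolding step_expectation_def
  proof (rule nn_integral_cong)
    fix a assume "a \<in> space (\<pi> i h)"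
    then have a: "a \<in> {0..T}" using sets_eq_imp_space_eq[OF s] by simp
    have Fa: "(\<lambda>x. F (h(i := (a, x)))) \<in> borel_measurable (borel :: 'a measure)"
      by (rule measurable_compose[OF measurable_append_sample[OF h a] F])
    have "distr R (isotropic_gaussian (\<theta> a) (\<Gamma> a)) (\<lambda>y. y (i, a)) = isotropic_gaussian (\<theta> a) (\<Gamma> a)"
      unfolding R_def
      using distr_PiM_component[of "{i} \<times> {0..T}" "\<lambda>p. isotropic_gaussian (\<theta> (snd p)) (\<Gamma> (snd p))" "(i, a)"] a
      by (simp add: prob_space_isotropic_gaussian)
    then have "(\<integral>\<^sup>+x. F (h(i := (a, x))) \<partial>isotropic_gaussian (\<theta> a) (\<Gamma> a)) =
        (\<integral>\<^sup>+x. F (h(i := (a, x))) \<partial>distr R (isotropic_gaussian (\<theta> a) (\<Gamma> a)) (\<lambda>y. y (i, a)))"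
      by simp
    also have "\<dots> = (\<integral>\<^sup>+y. F (h(i := (a, y (i, a)))) \<partial>R)"
      using comp[OF a] Fa by (subst nn_integral_distr) (simp_all add: measurable_cong_sets[OF sets_isotropic_gaussian refl])
    finally show "(\<integral>\<^sup>+y. F (h(i := (a, y (i, a)))) \<partial>R) =
        (\<integral>\<^sup>+x. F (h(i := (a, x))) \<partial>isotropic_gaussian (\<theta> a) (\<Gamma> a))" by simp
  qed
  finally show ?thesis .
qed

text \<open>The tower property, and the place where independence of the table enters: the history
  before step \<open>i\<close> does not see row \<open>i\<close>, so that row can be integrated out
  first. The table model thereby becomes a sequence of fresh draws.\<close>

lemma hist_expectation_Suc:
  assumes i: "i < N" and F[measurable]: "F \<in> borel_measurable (hist_space T (Suc i))"
  shows "hist_expectation \<theta> (Suc i) F = hist_expectation \<theta> i (step_expectation \<theta> i F)"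
proof -
  define M where "M p = isotropic_gaussian (\<theta> (snd p)) (\<Gamma> (snd p))" for p :: "nat \<times> nat"
  define I where "I = ({0..<N} - {i}) \<times> {0..T}"
  define J where "J = {i} \<times> {0..T}"
  have IJ: "I \<inter> J = {}" "finite I" "finite J" "I \<union> J = {0..<N} \<times> {0..T}"
    using i by (auto simp: I_def J_def)
  interpret product_prob_space M "I \<union> J"
    by (intro product_prob_spaceI) (simp add: M_def prob_space_isotropic_gaussian)
  have table: "sample_table T N \<theta> \<Gamma> = PiM (I \<union> J) M"
    by (simp add: sample_table_def IJ M_def[abs_def] case_prod_beta')
  have sT: "sets (PiM (I \<union> J) M) = sets tables"
    unfolding IJ by (intro sets_PiM_cong) (auto simp: M_def)
  have pJ: "prob_space (PiM J M)"
    by (intro prob_space_PiM) (simp add: M_def prob_space_isotropic_gaussian)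
  have \<pi>i: "\<pi> i \<in> hist_space T i \<rightarrow>\<^sub>M prob_algebra (count_space {0..T})" using i by simp
  have meas: "(\<lambda>Z. \<integral>\<^sup>+h. G h \<partial>history_law T \<pi> Z j) \<in> borel_measurable (PiM (I \<union> J) M)"
    if "j \<le> N" "G \<in> borel_measurable (hist_space T j)" for j G
    using measurable_nn_integral_history_law[OF that] by (simp add: measurable_cong_sets[OF sT refl])
  have "hist_expectation \<theta> (Suc i) F =
      (\<integral>\<^sup>+x. \<integral>\<^sup>+y. \<integral>\<^sup>+h. F h \<partial>history_law T \<pi> (merge I J (x, y)) (Suc i) \<partial>PiM J M \<partial>PiM I M)"
    unfolding hist_expectation_def table
    using i by (intro product_nn_integral_fold IJ meas F) simp
  also have "\<dots> = (\<integral>\<^sup>+x. \<integral>\<^sup>+y. \<integral>\<^sup>+h. step_expectation \<theta> i F h \<partial>history_law T \<pi> (merge I J (x, y)) i \<partial>PiM J M \<partial>PiM I M)"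
  proof (rule nn_integral_cong)
    fix x assume x: "x \<in> space (PiM I M)"
    \<comment> \<open>The law of the past is constant in the row \<open>y\<close>; any filler for
      row \<open>i\<close> gives the same measure.\<close>
    define P where "P = history_law T \<pi> (merge I J (x, \<lambda>_. undefined)) i"
    have P: "history_law T \<pi> (merge I J (x, y)) i = P" for y
      unfolding P_def by (rule history_law_cong) (auto simp: merge_def J_def)
    have Z: "merge I J (x, y) \<in> space tables" if "y \<in> space (PiM J M)" for y
      using x that unfolding sets_eq_imp_space_eq[OF sT, symmetric]
      by (auto simp: space_PiM PiE_iff merge_def extensional_def)
    obtain y0 where "y0 \<in> space (PiM J M)" using prob_space.not_empty[OF pJ] by blast
    from measurable_space[OF measurable_history_law[of i] Z[OF this]] i
    have sP: "sets P = sets (hist_space T i)" and pP: "prob_space P"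
      by (simp_all add: space_prob_algebra P)
    have spP: "space P = space (hist_space T i)" by (rule sets_eq_imp_space_eq[OF sP])
    have sJ: "sets (PiM J M) = sets (\<Pi>\<^sub>M p\<in>J. borel)" by (intro sets_PiM_cong) (auto simp: M_def)
    let ?f = "\<lambda>h y. \<integral>\<^sup>+a. F (h(i := (a, y (i, a)))) \<partial>\<pi> i h"
    have "(\<lambda>w. snd (fst w) (i, snd w)) \<in> (hist_space T i \<Otimes>\<^sub>M PiM J M) \<Otimes>\<^sub>M count_space {0..T} \<rightarrow>\<^sub>M borel"
    proof (rule measurable_compose_countable'[where f = "\<lambda>a w. snd (fst w) (i, a)" and I = "{0..T}" and g = snd,
        OF measurable_compose[OF measurable_compose[OF measurable_fst measurable_snd]]])
      show "(\<lambda>y. y (i, a)) \<in> PiM J M \<rightarrow>\<^sub>M borel" if "a \<in> {0..T}" for a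
        using that unfolding measurable_cong_sets[OF sJ refl]
        by (intro measurable_component_singleton) (simp add: J_def)
    qed auto
    then have "(\<lambda>w. (fst (fst w))(i := (snd w, snd (fst w) (i, snd w)))) \<in>
        (hist_space T i \<Otimes>\<^sub>M PiM J M) \<Otimes>\<^sub>M count_space {0..T} \<rightarrow>\<^sub>M hist_space T (Suc i)"
      by (rule measurable_hist_append[OF measurable_compose[OF measurable_fst measurable_fst] measurable_snd])
    from measurable_compose[OF this F]
    have "case_prod ?f \<in> borel_measurable (hist_space T i \<Otimes>\<^sub>M PiM J M)"
      unfolding case_prod_beta
      by (intro nn_integral_measurable_subprob_algebra2[where N = "count_space {0..T}"]
          measurable_compose[OF measurable_fst measurable_prob_algebraD[OF \<pi>i]])
         (simp add: case_prod_beta')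
    then have f: "case_prod ?f \<in> borel_measurable (P \<Otimes>\<^sub>M PiM J M)"
      by (simp add: measurable_cong_sets[OF sets_pair_measure_cong[OF sP refl] refl])
    have "(\<integral>\<^sup>+y. \<integral>\<^sup>+h. F h \<partial>history_law T \<pi> (merge I J (x, y)) (Suc i) \<partial>PiM J M) =
        (\<integral>\<^sup>+y. \<integral>\<^sup>+h. ?f h y \<partial>P \<partial>PiM J M)"
    proof (rule nn_integral_cong)
      fix y assume y: "y \<in> space (PiM J M)"
      show "(\<integral>\<^sup>+h. F h \<partial>history_law T \<pi> (merge I J (x, y)) (Suc i)) = (\<integral>\<^sup>+h. ?f h y \<partial>P)"
        unfolding nn_integral_history_law_Suc[OF i F Z[OF y]] P
      proof (intro nn_integral_cong)
        fix h a assume "h \<in> space P" and a: "a \<in> space (\<pi> i h)"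
        \<comment> \<open>The range of \<open>a\<close> matters: outside \<open>I\<close> and
          \<open>J\<close>, \<open>merge\<close> returns a default value instead of a
          sample.\<close>
        then have "space (\<pi> i h) = {0..T}"
          using measurable_space[OF \<pi>i] sets_eq_imp_space_eq[of "\<pi> i h" "count_space {0..T}"]
          by (auto simp: space_prob_algebra spP)
        then have "(i, a) \<in> J" "(i, a) \<notin> I" using a by (auto simp: I_def J_def)
        then show "F (h(i := (a, merge I J (x, y) (i, a)))) = F (h(i := (a, y (i, a))))"
          by (simp add: merge_def)
      qed
    qed
    also have "\<dots> = (\<integral>\<^sup>+h. \<integral>\<^sup>+y. ?f h y \<partial>PiM J M \<partial>P)"
      using f by (intro pair_sigma_finite.Fubini' pair_sigma_finite.intro prob_space_imp_sigma_finite pJ pP)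
    also have "\<dots> = (\<integral>\<^sup>+h. step_expectation \<theta> i F h \<partial>P)"
      by (intro nn_integral_cong, unfold M_def J_def, rule nn_integral_row[OF i F]) (simp add: spP)
    \<comment> \<open>The integrand does not depend on \<open>y\<close>, so averaging over the
      probability measure of row \<open>i\<close> restores the full table.\<close>
    also have "\<dots> = (\<integral>\<^sup>+y. \<integral>\<^sup>+h. step_expectation \<theta> i F h \<partial>history_law T \<pi> (merge I J (x, y)) i \<partial>PiM J M)"
      using prob_space.emeasure_space_1[OF pJ] by (simp add: P)
    finally show "(\<integral>\<^sup>+y. \<integral>\<^sup>+h. F h \<partial>history_law T \<pi> (merge I J (x, y)) (Suc i) \<partial>PiM J M) = \<dots>" .
  qed
  also have "\<dots> = hist_expectation \<theta> i (step_expectation \<theta> i F)"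
    unfolding hist_expectation_def table
    using i by (intro product_nn_integral_fold[symmetric] IJ meas measurable_step_expectation F) auto
  finally show ?thesis .
qed

section \<open>Monotonicity and linearity of expectations over histories\<close>

lemma sets_history_law:
  assumes "i \<le> N" "Z \<in> space (sample_table T N \<theta> \<Gamma>)"
  shows "sets (history_law T \<pi> Z i) = sets (hist_space T i)" "prob_space (history_law T \<pi> Z i)"
  using measurable_space[OF measurable_history_law[OF assms(1)], of Z] assms(2)
  by (auto simp: space_prob_algebra sets_eq_imp_space_eq[OF sets_sample_table])

lemma measurable_nn_integral_history_law_table:
  assumes "i \<le> N" "F \<in> borel_measurable (hist_space T i)"
  shows "(\<lambda>Z. \<integral>\<^sup>+h. F h \<partial>history_law T \<pi> Z i) \<in> borel_measurable (sample_table T N \<theta> \<Gamma>)"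
  using measurable_nn_integral_history_law[OF assms]
  by (simp add: measurable_cong_sets[OF sets_sample_table refl])

lemma hist_expectation_mono:
  assumes "i \<le> N" "\<And>h. h \<in> space (hist_space T i) \<Longrightarrow> F h \<le> G h"
  shows "hist_expectation \<theta> i F \<le> hist_expectation \<theta> i G"
  unfolding hist_expectation_def
  using assms sets_eq_imp_space_eq[OF sets_history_law(1)[OF assms(1)]]
  by (intro nn_integral_mono) auto

lemma hist_expectation_cong:
  assumes "i \<le> N" "\<And>h. h \<in> space (hist_space T i) \<Longrightarrow> F h = G h"
  shows "hist_expectation \<theta> i F = hist_expectation \<theta> i G"
  using assms by (intro antisym hist_expectation_mono) auto

lemma hist_expectation_const:
  assumes "i \<le> N"
  shows "hist_expectation \<theta> i (\<lambda>_. c) = c"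
proof -
  have "hist_expectation \<theta> i (\<lambda>_. c) = (\<integral>\<^sup>+Z. c \<partial>sample_table T N \<theta> \<Gamma>)"
    unfolding hist_expectation_def
    using prob_space.emeasure_space_1[OF sets_history_law(2)[OF assms]]
    by (intro nn_integral_cong) simp
  then show ?thesis
    using prob_space.emeasure_space_1[OF prob_space_sample_table[of T N \<theta> \<Gamma>]] by simp
qed

lemma hist_expectation_add:
  assumes "i \<le> N" and [measurable]: "F \<in> borel_measurable (hist_space T i)" "G \<in> borel_measurable (hist_space T i)"
  shows "hist_expectation \<theta> i (\<lambda>h. F h + G h) = hist_expectation \<theta> i F + hist_expectation \<theta> i G"
proof -
  have "hist_expectation \<theta> i (\<lambda>h. F h + G h) =
      (\<integral>\<^sup>+Z. (\<integral>\<^sup>+h. F h \<partial>history_law T \<pi> Z i) + (\<integral>\<^sup>+h. G h \<partial>history_law T \<pi> Z i) \<partial>sample_table T N \<theta> \<Gamma>)"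
    unfolding hist_expectation_def using assms
    by (intro nn_integral_cong nn_integral_add) (simp_all add: measurable_cong_sets[OF sets_history_law(1) refl])
  then show ?thesis
    unfolding hist_expectation_def using assms
    by (simp add: nn_integral_add measurable_nn_integral_history_law_table)
qed

lemma hist_expectation_cmult:
  assumes "i \<le> N" and "F \<in> borel_measurable (hist_space T i)"
  shows "hist_expectation \<theta> i (\<lambda>h. c * F h) = c * hist_expectation \<theta> i F"
proof -
  have "hist_expectation \<theta> i (\<lambda>h. c * F h) =
      (\<integral>\<^sup>+Z. c * (\<integral>\<^sup>+h. F h \<partial>history_law T \<pi> Z i) \<partial>sample_table T N \<theta> \<Gamma>)"
    unfolding hist_expectation_def using assms
    by (intro nn_integral_cong nn_integral_cmult) (simp add: measurable_cong_sets[OF sets_history_law(1) refl])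
  then show ?thesis
    unfolding hist_expectation_def using assms
    by (simp add: nn_integral_cmult measurable_nn_integral_history_law_table)
qed

lemma hist_expectation_sum:
  assumes "i \<le> N" "finite B" "\<And>b. b \<in> B \<Longrightarrow> F b \<in> borel_measurable (hist_space T i)"
  shows "hist_expectation \<theta> i (\<lambda>h. \<Sum>b\<in>B. F b h) = (\<Sum>b\<in>B. hist_expectation \<theta> i (F b))"
  using assms(2,3)
proof (induction B)
  case empty
  then show ?case using hist_expectation_const[OF assms(1)] by simp
next
  case (insert b B)
  then show ?case using assms(1) by (simp add: hist_expectation_add)
qed

section \<open>Change of measure along a history\<close>

lemma measurable_prod_likelihood:
  fixes r :: "nat \<times> 'a \<Rightarrow> ennreal"
  assumes "r \<in> borel_measurable (obs_space T)"
  shows "(\<lambda>h. \<Prod>j<i. r (h j)) \<in> borel_measurable (hist_space T i)"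
proof (rule borel_measurable_prod_ennreal)
  fix j assume "j \<in> {..<i}"
  then have "(\<lambda>h. h j) \<in> hist_space T i \<rightarrow>\<^sub>M obs_space T"
    unfolding hist_space_def by (intro measurable_component_singleton) simp
  then show "(\<lambda>h. r (h j)) \<in> borel_measurable (hist_space T i)"
    by (rule measurable_compose[OF _ assms])
qed

text \<open>
  The policy contributes the same factor under both instances, so it cancels in the likelihood ratio
  of the history. Sources with the same law under both may be point masses.
\<close>

lemma hist_expectation_likelihood:
  fixes \<theta> m :: "nat \<Rightarrow> 'a"
  assumes r: "r \<in> borel_measurable (obs_space T)"
    and dens: "\<And>a. a \<le> T \<Longrightarrow> isotropic_gaussian (\<theta> a) (\<Gamma> a) =
      density (isotropic_gaussian (m a) (\<Gamma> a)) (\<lambda>s. r (a, s))"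
  shows "i \<le> N \<Longrightarrow> F \<in> borel_measurable (hist_space T i) \<Longrightarrow>
    hist_expectation \<theta> i F = hist_expectation m i (\<lambda>h. (\<Prod>j<i. r (h j)) * F h)"
proof (induction i arbitrary: F)
  case 0
  have "hist_expectation \<theta>' 0 F = F (\<lambda>_. undefined)" for \<theta>'
    using hist_expectation_cong[of 0 F "\<lambda>_. F (\<lambda>_. undefined)" \<theta>'] hist_expectation_const[of 0]
    by (simp add: space_hist_space_0)
  then show ?case by simp
next
  case (Suc i)
  then have i: "i < N" and iN: "i \<le> N" and F[measurable]: "F \<in> borel_measurable (hist_space T (Suc i))"
    by auto
  let ?L = "\<lambda>i h. \<Prod>j<i. r (h j)"
  have LF: "(\<lambda>h. ?L (Suc i) h * F h) \<in> borel_measurable (hist_space T (Suc i))"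
    using measurable_prod_likelihood[OF r] F by (rule borel_measurable_times_ennreal)
  \<comment> \<open>The induction hypothesis changes the measure for the past. It is applied to the
    step expectation of \<open>F\<close>, which is why \<open>F\<close> is generalised.\<close>
  have "hist_expectation \<theta> (Suc i) F = hist_expectation m i (\<lambda>h. ?L i h * step_expectation \<theta> i F h)"
    unfolding hist_expectation_Suc[OF i F] using iN i F
    by (intro Suc.IH measurable_step_expectation)
  also have "\<dots> = hist_expectation m i (step_expectation m i (\<lambda>h. ?L (Suc i) h * F h))"
  proof (rule hist_expectation_cong[OF iN])
    fix h :: "nat \<Rightarrow> nat \<times> 'a" assume h: "h \<in> space (hist_space T i)"
    have \<pi>i: "\<pi> i \<in> hist_space T i \<rightarrow>\<^sub>M prob_algebra (count_space {0..T})" using i by simp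
    have s: "sets (\<pi> i h) = sets (count_space {0..T})"
      using measurable_space[OF \<pi>i h] by (simp add: space_prob_algebra)
    have "?L i h * step_expectation \<theta> i F h =
        (\<integral>\<^sup>+a. ?L i h * (\<integral>\<^sup>+x. F (h(i := (a, x))) \<partial>isotropic_gaussian (\<theta> a) (\<Gamma> a)) \<partial>\<pi> i h)"
      unfolding step_expectation_def
      by (rule nn_integral_cmult[symmetric]) (simp add: measurable_cong_sets[OF s refl])
    also have "\<dots> = step_expectation m i (\<lambda>h. ?L (Suc i) h * F h) h"
      unfolding step_expectation_def
    proof (rule nn_integral_cong)
      fix a assume "a \<in> space (\<pi> i h)"
      then have a: "a \<in> {0..T}" using sets_eq_imp_space_eq[OF s] by simp
      have [measurable]: "(\<lambda>x. F (h(i := (a, x)))) \<in> borel_measurable (borel :: 'a measure)"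
        by (rule measurable_compose[OF measurable_append_sample[OF h a] F])
      have [measurable]: "(\<lambda>x. r (a, x)) \<in> borel_measurable (borel :: 'a measure)"
        using a r unfolding obs_space_def by (intro measurable_compose[OF measurable_Pair1', of a]) auto
      have "(\<integral>\<^sup>+x. F (h(i := (a, x))) \<partial>isotropic_gaussian (\<theta> a) (\<Gamma> a)) =
          (\<integral>\<^sup>+x. r (a, x) * F (h(i := (a, x))) \<partial>isotropic_gaussian (m a) (\<Gamma> a))"
        using a by (simp add: dens nn_integral_density)
      then have "?L i h * (\<integral>\<^sup>+x. F (h(i := (a, x))) \<partial>isotropic_gaussian (\<theta> a) (\<Gamma> a)) =
          (\<integral>\<^sup>+x. ?L i h * (r (a, x) * F (h(i := (a, x)))) \<partial>isotropic_gaussian (m a) (\<Gamma> a))"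
        by (simp add: nn_integral_cmult)
      \<comment> \<open>Updating position \<open>i\<close> leaves the product over
        \<open>j < i\<close> unchanged, and the new factor of the longer product is
        \<open>r (a, x)\<close>.\<close>
      also have "\<dots> = (\<integral>\<^sup>+x. ?L (Suc i) (h(i := (a, x))) * F (h(i := (a, x))) \<partial>isotropic_gaussian (m a) (\<Gamma> a))"
        by (simp add: mult.assoc)
      finally show "?L i h * (\<integral>\<^sup>+x. F (h(i := (a, x))) \<partial>isotropic_gaussian (\<theta> a) (\<Gamma> a)) = \<dots>" .
    qed
    finally show "?L i h * step_expectation \<theta> i F h = step_expectation m i (\<lambda>h. ?L (Suc i) h * F h) h" .
  qed
  also have "\<dots> = hist_expectation m (Suc i) (\<lambda>h. ?L (Suc i) h * F h)"
    by (rule hist_expectation_Suc[OF i LF, symmetric])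
  finally show ?case .
qed

section \<open>The risk as an expectation over histories\<close>

lemma measurable_nn_integral_estimator [measurable]:
  assumes "f \<in> borel_measurable borel"
  shows "(\<lambda>h. \<integral>\<^sup>+x. f x \<partial>est h) \<in> borel_measurable (hist_space T N)"
  using assms
  by (intro measurable_compose[OF measurable_prob_algebraD[OF measurable_estimator]]
      nn_integral_measurable_subprob_algebra) auto

text \<open>Once averaged over \<open>est h\<close>, the loss of a randomised estimator is a
  function of the history alone, to which the change of measure applies.\<close>

lemma risk_eq_hist_expectation:
  "risk T N \<pi> est \<theta> \<Gamma> = hist_expectation \<theta> N (\<lambda>h. \<integral>\<^sup>+x. ennreal ((norm (x - \<theta> 0))\<^sup>2) \<partial>est h)"
proof -
  have K: "(\<lambda>Z. history_law T \<pi> Z N \<bind> est) \<in> sample_table T N \<theta> \<Gamma> \<rightarrow>\<^sub>M subprob_algebra borel"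
    using measurable_bind_prob_space[OF measurable_history_law[OF order_refl] measurable_estimator]
    by (simp add: measurable_cong_sets[OF sets_sample_table refl] measurable_prob_algebraD)
  show ?thesis
    unfolding risk_def output_law_def hist_expectation_def
  proof (subst nn_integral_bind[OF _ K], simp, rule nn_integral_cong)
    fix Z assume "Z \<in> space (sample_table T N \<theta> \<Gamma>)"
    then have "est \<in> history_law T \<pi> Z N \<rightarrow>\<^sub>M subprob_algebra borel"
      using measurable_prob_algebraD[OF measurable_estimator]
      by (simp add: measurable_cong_sets[OF sets_history_law(1) refl])
    then show "(\<integral>\<^sup>+x. ennreal ((norm (x - \<theta> 0))\<^sup>2) \<partial>(history_law T \<pi> Z N \<bind> est)) =
        (\<integral>\<^sup>+h. \<integral>\<^sup>+x. ennreal ((norm (x - \<theta> 0))\<^sup>2) \<partial>est h \<partial>history_law T \<pi> Z N)"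
      by (rule nn_integral_bind[rotated]) measurable
  qed
qed

end

section \<open>The two-point bound\<close>

text \<open>Multiplying by \<open>a + a'\<close> turns the two squares into a square plus \<open>4 a a' \<delta>\<^sup>2\<close>.\<close>

lemma two_point_pointwise:
  fixes a a' y \<delta> \<kappa> :: real
  assumes "a > 0" "a' > 0" "a * a' \<ge> \<kappa>" "\<kappa> \<ge> 0"
  shows "4 * \<delta>\<^sup>2 * \<kappa> \<le> a * (y - \<delta>)\<^sup>2 + a' * (y + \<delta>)\<^sup>2 + \<delta>\<^sup>2 * \<kappa> * (a + a')"
    (is "_ \<le> ?R")
proof -
  have "(4 * \<delta>\<^sup>2 * \<kappa>) * (a + a') \<le> 4 * (\<delta>\<^sup>2 * \<kappa>) + \<delta>\<^sup>2 * \<kappa> * (a + a')\<^sup>2"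
  proof -
    \<comment> \<open>With \<open>S = a + a'\<close> this is
      \<open>4 * S \<le> 4 + S\<^sup>2\<close>, tight at \<open>S = 2\<close>, which is the mean of
      the sum of two likelihood ratios.\<close>
    have "0 \<le> (\<delta>\<^sup>2 * \<kappa>) * (a + a' - 2)\<^sup>2" using assms by simp
    then show ?thesis by (simp add: power2_eq_square algebra_simps)
  qed
  also have "\<dots> \<le> 4 * (\<delta>\<^sup>2 * (a * a')) + \<delta>\<^sup>2 * \<kappa> * (a + a')\<^sup>2"
    using assms by (simp add: mult_left_mono)
  also have "\<dots> \<le> ((a + a') * y - (a - a') * \<delta>)\<^sup>2 + 4 * (\<delta>\<^sup>2 * (a * a')) + \<delta>\<^sup>2 * \<kappa> * (a + a')\<^sup>2"
    by simp
  also have "\<dots> = ?R * (a + a')"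
    by (simp add: power2_eq_square algebra_simps)
  finally show ?thesis using assms by simp
qed

text \<open>The likelihood ratio of one observation when the means of the models in \<open>I\<close>
  move from \<open>m\<close> to \<open>m + u\<close>. The other models keep their law; their ratio
  is 1 even if their variance vanishes.\<close>

definition shift_likelihood ::
  "nat set \<Rightarrow> (nat \<Rightarrow> real) \<Rightarrow> (nat \<Rightarrow> 'a) \<Rightarrow> 'a \<Rightarrow> nat \<times> 'a::euclidean_space \<Rightarrow> real" where
  "shift_likelihood I \<Gamma> m u p =
     (if fst p \<in> I then exp ((snd p - m (fst p)) \<bullet> u / \<Gamma> (fst p) - u \<bullet> u / (2 * \<Gamma> (fst p))) else 1)"

lemma shift_likelihood_pos: "shift_likelihood I \<Gamma> m u p > 0"
  by (simp add: shift_likelihood_def)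

text \<open>For opposite shifts the terms linear in the sample cancel. What is left depends only on
  the variance, and is smallest at the smallest variance allowed in \<open>I\<close>.\<close>

lemma shift_likelihood_mult_minus:
  assumes "fst p \<in> I \<Longrightarrow> s \<le> \<Gamma> (fst p)" "0 < s"
  shows "exp (- (u \<bullet> u / s)) \<le> shift_likelihood I \<Gamma> m u p * shift_likelihood I \<Gamma> m (- u) p"
proof (cases "fst p \<in> I")
  case True
  have "u \<bullet> u / \<Gamma> (fst p) \<le> u \<bullet> u / s"
    using assms True by (intro divide_left_mono) auto
  then show ?thesis using True by (simp add: shift_likelihood_def flip: exp_add)
next
  case False
  then show ?thesis using assms by (simp add: shift_likelihood_def)
qed

lemma measurable_shift_likelihood:
  "shift_likelihood I \<Gamma> m u \<in> borel_measurable (obs_space T)"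
  unfolding obs_space_def
proof (rule measurable_pair_measure_countable1)
  fix a
  show "(\<lambda>x. shift_likelihood I \<Gamma> m u (a, x)) \<in> borel_measurable borel"
    unfolding shift_likelihood_def by (cases "a \<in> I") simp_all
qed auto

context cl_algorithm
begin

text \<open>Both instances are rewritten as densities with respect to their midpoint
  \<open>m\<close>; then \<open>two_point_pointwise\<close> is integrated over output and history.
  The number \<open>c\<close> is the centre of the two coordinate values to be told apart.\<close>

lemma two_point_bound:
  fixes \<theta> \<theta>' m :: "nat \<Rightarrow> 'a"
  assumes b: "b \<in> Basis" and s: "s > 0" and \<delta>: "real N * \<delta>\<^sup>2 \<le> s"
    and I: "\<And>t. t \<in> I \<Longrightarrow> s \<le> \<Gamma> t"
    and \<theta>: "\<And>t. t \<le> T \<Longrightarrow> \<theta> t = m t + (if t \<in> I then \<delta> *\<^sub>R b else 0)"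
    and \<theta>': "\<And>t. t \<le> T \<Longrightarrow> \<theta>' t = m t - (if t \<in> I then \<delta> *\<^sub>R b else 0)"
  shows "ennreal (2 * \<delta>\<^sup>2 * exp (- 1)) \<le>
    hist_expectation \<theta> N (\<lambda>h. \<integral>\<^sup>+x. ennreal ((x \<bullet> b - (c + \<delta>))\<^sup>2) \<partial>est h) +
    hist_expectation \<theta>' N (\<lambda>h. \<integral>\<^sup>+x. ennreal ((x \<bullet> b - (c - \<delta>))\<^sup>2) \<partial>est h)"
proof -
  define r where "r = shift_likelihood I \<Gamma> m (\<delta> *\<^sub>R b)"
  define r' where "r' = shift_likelihood I \<Gamma> m (- (\<delta> *\<^sub>R b))"
  define l where "l h = (\<Prod>j<N. r (h j))" for h :: "nat \<Rightarrow> nat \<times> 'a"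
  define l' where "l' h = (\<Prod>j<N. r' (h j))" for h :: "nat \<Rightarrow> nat \<times> 'a"
  have r: "(\<lambda>p. ennreal (r p)) \<in> borel_measurable (obs_space T)"
    and r': "(\<lambda>p. ennreal (r' p)) \<in> borel_measurable (obs_space T)"
    unfolding r_def r'_def by (intro measurable_compose[OF measurable_shift_likelihood measurable_ennreal])+
  have pos: "l h > 0" "l' h > 0" for h
    by (auto simp: l_def l'_def r_def r'_def intro!: prod_pos shift_likelihood_pos)
  have l: "ennreal (l h) = (\<Prod>j<N. ennreal (r (h j)))" and l': "ennreal (l' h) = (\<Prod>j<N. ennreal (r' (h j)))" for h
    by (simp_all add: l_def l'_def r_def r'_def prod_ennreal less_imp_le[OF shift_likelihood_pos])
  have lm[measurable]: "(\<lambda>h. ennreal (l h)) \<in> borel_measurable (hist_space T N)"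
    "(\<lambda>h. ennreal (l' h)) \<in> borel_measurable (hist_space T N)"
    unfolding l l' by (intro measurable_prod_likelihood r r')+
  have I0: "0 < \<Gamma> t" if "t \<in> I" for t using I[OF that] s by simp
  have dens: "isotropic_gaussian (\<theta> a) (\<Gamma> a) = density (isotropic_gaussian (m a) (\<Gamma> a)) (\<lambda>x. ennreal (r (a, x)))"
    "isotropic_gaussian (\<theta>' a) (\<Gamma> a) = density (isotropic_gaussian (m a) (\<Gamma> a)) (\<lambda>x. ennreal (r' (a, x)))"
    if "a \<le> T" for a
    using isotropic_gaussian_add[OF I0, of a "m a" "\<delta> *\<^sub>R b"] isotropic_gaussian_add[OF I0, of a "m a" "- (\<delta> *\<^sub>R b)"]
    by (simp_all add: \<theta>[OF that] \<theta>'[OF that] r_def r'_def shift_likelihood_def density_1)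
  have E: "hist_expectation \<theta> N F = hist_expectation m N (\<lambda>h. ennreal (l h) * F h)"
    "hist_expectation \<theta>' N F = hist_expectation m N (\<lambda>h. ennreal (l' h) * F h)"
    if "F \<in> borel_measurable (hist_space T N)" for F
    unfolding l l'
    by (intro hist_expectation_likelihood r r' dens order_refl that; assumption)+
  have prod: "exp (- 1) \<le> l h * l' h" for h
  proof -
    \<comment> \<open>Each of the \<open>N\<close> steps costs at most a factor
      \<open>exp (- \<delta>\<^sup>2 / s)\<close>, whichever model it samples.\<close>
    have "exp (- 1) \<le> exp (real N * - (\<delta>\<^sup>2 / s))" using \<delta> s by (simp add: field_simps)
    also have "\<dots> = (\<Prod>j<N. exp (- ((\<delta> *\<^sub>R b) \<bullet> (\<delta> *\<^sub>R b) / s)))"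
      unfolding exp_of_nat_mult using b by (simp add: power2_eq_square)
    also have "\<dots> \<le> (\<Prod>j<N. r (h j) * r' (h j))"
      unfolding r_def r'_def using I s by (intro prod_mono conjI shift_likelihood_mult_minus) auto
    finally show ?thesis by (simp add: l_def l'_def prod.distrib)
  qed
  define F where "F h = (\<integral>\<^sup>+x. ennreal ((x \<bullet> b - (c + \<delta>))\<^sup>2) \<partial>est h)" for h
  define F' where "F' h = (\<integral>\<^sup>+x. ennreal ((x \<bullet> b - (c - \<delta>))\<^sup>2) \<partial>est h)" for h
  have Fm[measurable]: "F \<in> borel_measurable (hist_space T N)" "F' \<in> borel_measurable (hist_space T N)"
    unfolding F_def[abs_def] F'_def[abs_def] by (intro measurable_nn_integral_estimator; measurable)+
  define k where "k = \<delta>\<^sup>2 * exp (- 1)"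
  have k: "k \<ge> 0" by (simp add: k_def)
  \<comment> \<open>The summand with factor \<open>k\<close> makes the bound linear in the
    likelihood ratios; under \<open>m\<close> its mean is exactly \<open>2 * k\<close>.\<close>
  have "ennreal (4 * k) \<le> (ennreal (l h) * F h + ennreal (l' h) * F' h) + ennreal k * (ennreal (l h) + ennreal (l' h))"
    if h: "h \<in> space (hist_space T N)" for h
  proof -
    have sets: "sets (est h) = sets borel" and p: "prob_space (est h)"
      using measurable_space[OF measurable_estimator h] by (simp_all add: space_prob_algebra)
    note [measurable_cong] = sets
    have "ennreal (4 * k) = (\<integral>\<^sup>+x. ennreal (4 * k) \<partial>est h)"
      using prob_space.emeasure_space_1[OF p] by simp
    also have "\<dots> \<le> (\<integral>\<^sup>+x. ennreal (l h) * ennreal ((x \<bullet> b - (c + \<delta>))\<^sup>2) +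
        ennreal (l' h) * ennreal ((x \<bullet> b - (c - \<delta>))\<^sup>2) + ennreal k * (ennreal (l h) + ennreal (l' h)) \<partial>est h)"
    proof (rule nn_integral_mono)
      fix x
      have "4 * k \<le> l h * (x \<bullet> b - (c + \<delta>))\<^sup>2 + l' h * (x \<bullet> b - (c - \<delta>))\<^sup>2 + k * (l h + l' h)"
        using two_point_pointwise[OF pos prod exp_ge_zero, where y = "x \<bullet> b - c" and \<delta> = \<delta>]
        by (simp add: k_def algebra_simps)
      from ennreal_leI[OF this] show "ennreal (4 * k) \<le> ennreal (l h) * ennreal ((x \<bullet> b - (c + \<delta>))\<^sup>2) +
        ennreal (l' h) * ennreal ((x \<bullet> b - (c - \<delta>))\<^sup>2) + ennreal k * (ennreal (l h) + ennreal (l' h))"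
        using pos[of h] k by (simp add: less_imp_le flip: ennreal_mult ennreal_plus)
    qed
    also have "\<dots> = (ennreal (l h) * F h + ennreal (l' h) * F' h) + ennreal k * (ennreal (l h) + ennreal (l' h))"
      using prob_space.emeasure_space_1[OF p] unfolding F_def F'_def
      by (simp add: nn_integral_add nn_integral_cmult)
    finally show ?thesis .
  qed
  from hist_expectation_mono[OF order_refl this, where \<theta> = m]
  have "ennreal (4 * k) \<le> hist_expectation m N (\<lambda>h. (ennreal (l h) * F h + ennreal (l' h) * F' h) +
      ennreal k * (ennreal (l h) + ennreal (l' h)))"
    by (simp add: hist_expectation_const)
  also have "\<dots> = (hist_expectation \<theta> N F + hist_expectation \<theta>' N F') +
      ennreal k * (hist_expectation m N (\<lambda>h. ennreal (l h)) + hist_expectation m N (\<lambda>h. ennreal (l' h)))"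
    by (simp add: hist_expectation_add hist_expectation_cmult E)
  \<comment> \<open>Likelihood ratios have mean one: the change of measure is applied to the
    constant 1.\<close>
  also have "hist_expectation m N (\<lambda>h. ennreal (l h)) = 1"
    using E(1)[of "\<lambda>_. 1"] hist_expectation_const[of N \<theta> 1] by simp
  also have "hist_expectation m N (\<lambda>h. ennreal (l' h)) = 1"
    using E(2)[of "\<lambda>_. 1"] hist_expectation_const[of N \<theta>' 1] by simp
  also have "ennreal k * (1 + 1) = ennreal (2 * k)"
    using k by (simp add: ennreal_mult mult.commute one_add_one)
  finally have "ennreal (2 * k) + ennreal (2 * k) \<le> ennreal (2 * k) + (hist_expectation \<theta> N F + hist_expectation \<theta>' N F')"
    using k by (simp add: add.commute flip: ennreal_plus)
  \<comment> \<open>Half of \<open>4 * k\<close> is cancelled; this is legitimate in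
    \<open>ennreal\<close> because \<open>2 * k\<close> is finite.\<close>
  then have "ennreal (2 * k) \<le> hist_expectation \<theta> N F + hist_expectation \<theta>' N F'"
    by (simp add: ennreal_add_left_cancel_le)
  then show ?thesis by (simp add: k_def F_def[abs_def] F'_def[abs_def] mult.assoc)
qed

end

section \<open>Hypercubes\<close>

text \<open>A vertex is indexed by the set \<open>V\<close> of coordinates with positive sign, so
  that flipping a coordinate inserts or removes an element.\<close>

definition hypercube_point :: "real \<Rightarrow> 'a set \<Rightarrow> 'a set \<Rightarrow> 'a::euclidean_space" where
  "hypercube_point \<delta> B V = (\<Sum>b\<in>B. (if b \<in> V then \<delta> else - \<delta>) *\<^sub>R b)"

lemma inner_hypercube_point:
  assumes "B \<subseteq> Basis" "b \<in> Basis"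
  shows "hypercube_point \<delta> B V \<bullet> b = (if b \<in> B then if b \<in> V then \<delta> else - \<delta> else 0)"
proof -
  have "finite B" using assms(1) finite_Basis by (rule finite_subset)
  have "hypercube_point \<delta> B V \<bullet> b = (\<Sum>b'\<in>B. if b' = b then if b \<in> V then \<delta> else - \<delta> else 0)"
    unfolding hypercube_point_def inner_sum_left
    using assms by (intro sum.cong) (auto simp: inner_Basis)
  then show ?thesis using \<open>finite B\<close> by simp
qed

lemma norm_hypercube_point:
  assumes "B \<subseteq> (Basis :: 'a::euclidean_space set)"
  shows "(norm (hypercube_point \<delta> B V))\<^sup>2 = real (card B) * \<delta>\<^sup>2"
proof -
  have "(norm (hypercube_point \<delta> B V))\<^sup>2 = (\<Sum>b\<in>Basis. (hypercube_point \<delta> B V \<bullet> b)\<^sup>2)"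
    unfolding power2_norm_eq_inner by (subst euclidean_inner) (simp add: power2_eq_square)
  also have "\<dots> = (\<Sum>b\<in>Basis. if b \<in> B then \<delta>\<^sup>2 else 0)"
    using assms by (intro sum.cong) (auto simp: inner_hypercube_point)
  also have "\<dots> = real (card B) * \<delta>\<^sup>2"
    using assms by (simp add: sum.If_cases Int_absorb1)
  finally show ?thesis .
qed

text \<open>The increment is split into two halves to exhibit the midpoint of the edge, which is the
  reference point of the two-point bound.\<close>

lemma hypercube_point_insert:
  assumes "finite B" "b \<in> B" "b \<notin> V"
  shows "hypercube_point \<delta> B (insert b V) = hypercube_point \<delta> B V + \<delta> *\<^sub>R b + \<delta> *\<^sub>R b"
proof -
  have "hypercube_point \<delta> (B - {b}) (insert b V) = hypercube_point \<delta> (B - {b}) V"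
    unfolding hypercube_point_def by (intro sum.cong) auto
  then show ?thesis
    using assms by (simp add: hypercube_point_def sum.remove[of B b])
qed

context cl_algorithm
begin

text \<open>The worst risk is at least the average over all vertices. For each coordinate the
  vertices pair up along edges, and each edge is a two-point problem.\<close>

lemma assouad_bound:
  fixes \<Theta> :: "'a set \<Rightarrow> nat \<Rightarrow> 'a"
  assumes B: "B \<subseteq> Basis" and s: "s > 0" and \<delta>: "real N * \<delta>\<^sup>2 \<le> s"
    and I: "\<And>t. t \<in> I \<Longrightarrow> s \<le> \<Gamma> t"
    and \<Theta>: "\<And>V t. V \<subseteq> B \<Longrightarrow> t \<le> T \<Longrightarrow> \<Theta> V t = a t + (if t \<in> I then hypercube_point \<delta> B V else 0)"
    and \<Theta>0: "\<And>V. V \<subseteq> B \<Longrightarrow> \<Theta> V 0 = hypercube_point \<delta> B V"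
    and R: "\<And>V. V \<subseteq> B \<Longrightarrow> risk T N \<pi> est (\<Theta> V) \<Gamma> \<le> R"
  shows "ennreal (real (card B) * (\<delta>\<^sup>2 * exp (- 1))) \<le> R"
proof -
  have finB: "finite B" using B finite_Basis by (rule finite_subset)
  define C where "C V b = hist_expectation (\<Theta> V) N (\<lambda>h. \<integral>\<^sup>+x. ennreal ((x \<bullet> b - \<Theta> V 0 \<bullet> b)\<^sup>2) \<partial>est h)" for V b
  define k where "k = ennreal (\<delta>\<^sup>2 * exp (- 1))"
  define n :: ennreal where "n = of_nat (card (Pow B))"
  \<comment> \<open>Division by the number of vertices in \<open>ennreal\<close> requires it to be
    neither 0 nor infinite.\<close>
  have n: "0 < n" "n < top"
    using finB by (simp_all add: n_def zero_less_iff_neq_zero card_eq_0_iff of_nat_less_top Pow_not_empty)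
  have pair: "2 * k \<le> C (insert b V) b + C V b" if b: "b \<in> B" "b \<notin> V" "V \<subseteq> B" for b V
  proof -
    have sub: "insert b V \<subseteq> B" using b by auto
    have ins: "hypercube_point \<delta> B (insert b V) = hypercube_point \<delta> B V + \<delta> *\<^sub>R b + \<delta> *\<^sub>R b"
      by (rule hypercube_point_insert[OF finB b(1,2)])
    have bB: "b \<in> Basis" using b B by auto
    \<comment> \<open>The midpoint of the edge has coordinate 0 along \<open>b\<close>, hence the
      centre 0 here.\<close>
    have "ennreal (2 * \<delta>\<^sup>2 * exp (- 1)) \<le>
        hist_expectation (\<Theta> (insert b V)) N (\<lambda>h. \<integral>\<^sup>+x. ennreal ((x \<bullet> b - (0 + \<delta>))\<^sup>2) \<partial>est h) +
        hist_expectation (\<Theta> V) N (\<lambda>h. \<integral>\<^sup>+x. ennreal ((x \<bullet> b - (0 - \<delta>))\<^sup>2) \<partial>est h)"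
    proof (rule two_point_bound[OF bB s \<delta> I])
      fix t assume t: "t \<le> T"
      let ?m = "\<lambda>t. a t + (if t \<in> I then hypercube_point \<delta> B V + \<delta> *\<^sub>R b else 0)"
      show "\<Theta> (insert b V) t = ?m t + (if t \<in> I then \<delta> *\<^sub>R b else 0)"
        using \<Theta>[OF sub t] by (simp add: ins)
      show "\<Theta> V t = ?m t - (if t \<in> I then \<delta> *\<^sub>R b else 0)"
        using \<Theta>[OF b(3) t] by simp
    qed
    moreover have "ennreal (2 * \<delta>\<^sup>2 * exp (- 1)) = 2 * k"
      by (simp add: k_def mult.assoc ennreal_mult)
    ultimately show ?thesis
      using b by (simp add: C_def \<Theta>0[OF sub] \<Theta>0[OF b(3)] inner_hypercube_point[OF B bB])
  qed
  have coord: "n * k \<le> (\<Sum>V\<in>Pow B. C V b)" if b: "b \<in> B" for b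
  proof -
    \<comment> \<open>Summing over all vertices meets every edge from both ends, which explains the
      factor 2 on both sides below.\<close>
    define flip where "flip V = (if b \<in> V then V - {b} else insert b V)" for V
    have "2 * (n * k) = (\<Sum>V\<in>Pow B. 2 * k)"
      by (simp add: n_def mult_ac)
    also have "\<dots> \<le> (\<Sum>V\<in>Pow B. C (flip V) b + C V b)"
    proof (rule sum_mono)
      fix V assume "V \<in> Pow B"
      then have V: "V \<subseteq> B" by simp
      show "2 * k \<le> C (flip V) b + C V b"
      proof (cases "b \<in> V")
        case True
        have "2 * k \<le> C (insert b (V - {b})) b + C (V - {b}) b" using V by (intro pair b) auto
        then show ?thesis using True by (simp add: flip_def insert_absorb add.commute)
      next
        case False
        then show ?thesis using pair[OF b False V] by (simp add: flip_def)
      qed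
    qed
    also have "\<dots> = (\<Sum>V\<in>Pow B. C (flip V) b) + (\<Sum>V\<in>Pow B. C V b)"
      by (rule sum.distrib)
    also have "(\<Sum>V\<in>Pow B. C (flip V) b) = (\<Sum>V\<in>Pow B. C V b)"
      using b by (intro sum.reindex_bij_witness[where i = flip and j = flip]) (auto simp: flip_def)
    finally have "2 * (n * k) \<le> 2 * (\<Sum>V\<in>Pow B. C V b)" by (simp add: mult_2)
    then show ?thesis by (subst (asm) ennreal_mult_le_mult_iff) simp_all
  qed
  have risk: "(\<Sum>b\<in>B. C V b) \<le> R" if V: "V \<subseteq> B" for V
  proof -
    have "(\<Sum>b\<in>B. C V b) = hist_expectation (\<Theta> V) N
        (\<lambda>h. \<Sum>b\<in>B. \<integral>\<^sup>+x. ennreal ((x \<bullet> b - \<Theta> V 0 \<bullet> b)\<^sup>2) \<partial>est h)"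
      unfolding C_def using finB by (intro hist_expectation_sum[symmetric] measurable_nn_integral_estimator) auto
    also have "\<dots> \<le> hist_expectation (\<Theta> V) N (\<lambda>h. \<integral>\<^sup>+x. ennreal ((norm (x - \<Theta> V 0))\<^sup>2) \<partial>est h)"
    proof (rule hist_expectation_mono[OF order_refl])
      fix h :: "nat \<Rightarrow> nat \<times> 'a" assume h: "h \<in> space (hist_space T N)"
      have [measurable_cong]: "sets (est h) = sets borel"
        using measurable_space[OF measurable_estimator h] by (simp add: space_prob_algebra)
      have "(\<Sum>b\<in>B. \<integral>\<^sup>+x. ennreal ((x \<bullet> b - \<Theta> V 0 \<bullet> b)\<^sup>2) \<partial>est h) =
          (\<integral>\<^sup>+x. (\<Sum>b\<in>B. ennreal ((x \<bullet> b - \<Theta> V 0 \<bullet> b)\<^sup>2)) \<partial>est h)"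
        by (rule nn_integral_sum[symmetric]) measurable
      also have "\<dots> \<le> (\<integral>\<^sup>+x. ennreal ((norm (x - \<Theta> V 0))\<^sup>2) \<partial>est h)"
      proof (rule nn_integral_mono)
        fix x
        have "(\<Sum>b\<in>B. (x \<bullet> b - \<Theta> V 0 \<bullet> b)\<^sup>2) \<le> (\<Sum>b\<in>Basis. (x \<bullet> b - \<Theta> V 0 \<bullet> b)\<^sup>2)"
          using B by (intro sum_mono2) auto
        also have "\<dots> = (norm (x - \<Theta> V 0))\<^sup>2"
          unfolding power2_norm_eq_inner euclidean_inner[of "x - \<Theta> V 0" "x - \<Theta> V 0"]
          by (simp add: power2_eq_square inner_diff_left)
        finally show "(\<Sum>b\<in>B. ennreal ((x \<bullet> b - \<Theta> V 0 \<bullet> b)\<^sup>2)) \<le> ennreal ((norm (x - \<Theta> V 0))\<^sup>2)"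
          by (simp add: ennreal_leI)
      qed
      finally show "(\<Sum>b\<in>B. \<integral>\<^sup>+x. ennreal ((x \<bullet> b - \<Theta> V 0 \<bullet> b)\<^sup>2) \<partial>est h) \<le>
          (\<integral>\<^sup>+x. ennreal ((norm (x - \<Theta> V 0))\<^sup>2) \<partial>est h)" .
    qed
    also have "\<dots> \<le> R"
      using R[OF V] by (simp add: risk_eq_hist_expectation)
    finally show ?thesis .
  qed
  \<comment> \<open>The average over vertices is exchanged with the sum over coordinates.\<close>
  have "n * (of_nat (card B) * k) = (\<Sum>b\<in>B. n * k)"
    by (simp add: mult_ac)
  also have "\<dots> \<le> (\<Sum>b\<in>B. \<Sum>V\<in>Pow B. C V b)"
    by (intro sum_mono coord)
  also have "\<dots> = (\<Sum>V\<in>Pow B. \<Sum>b\<in>B. C V b)"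
    by (rule sum.swap)
  also have "\<dots> \<le> (\<Sum>V\<in>Pow B. R)"
    by (intro sum_mono risk) simp
  also have "\<dots> = n * R"
    by (simp add: n_def)
  finally have "of_nat (card B) * k \<le> R"
    using n by (subst (asm) ennreal_mult_le_mult_iff) auto
  then show ?thesis
    by (simp add: k_def ennreal_mult ennreal_of_nat_eq_real_of_nat)
qed

end

section \<open>Lower bounds on the minimax risk\<close>

text \<open>\<open>assouad_bound\<close> for an arbitrary algorithm, with its worst-case risk over
  \<open>\<Psi>\<close> as \<open>R\<close>. Since \<open>0 \<in> I\<close> and
  \<open>a 0 = 0\<close>, the target itself is the vertex.\<close>

lemma minimax_risk_hypercube_bound:
  fixes a :: "nat \<Rightarrow> 'a::euclidean_space"
  assumes B: "B \<subseteq> Basis" and s: "s > 0" and \<delta>: "real N * \<delta>\<^sup>2 \<le> s"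
    and I: "0 \<in> I" "\<And>t. t \<in> I \<Longrightarrow> s \<le> \<Gamma> t" and a: "a 0 = 0"
    and \<Psi>: "\<And>V. V \<subseteq> B \<Longrightarrow>
      restrict (\<lambda>t. a t + (if t \<in> I then hypercube_point \<delta> B V else 0)) {0..T} \<in> \<Psi>"
  shows "ennreal (real (card B) * (\<delta>\<^sup>2 * exp (- 1))) \<le> minimax_risk T N \<Psi> \<Gamma>"
  unfolding minimax_risk_def
proof (rule INF_greatest, clarify)
  fix \<pi> :: "'a policy" and est :: "'a estimator"
  assume "(\<pi>, est) \<in> cl_algorithms T N"
  then interpret cl_algorithm T N \<pi> est \<Gamma> by unfold_locales
  let ?\<Theta> = "\<lambda>V. restrict (\<lambda>t. a t + (if t \<in> I then hypercube_point \<delta> B V else 0)) {0..T}"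
  show "ennreal (real (card B) * (\<delta>\<^sup>2 * exp (- 1))) \<le> (SUP \<theta>\<in>\<Psi>. risk T N \<pi> est \<theta> \<Gamma>)"
  proof (rule assouad_bound[where \<Theta> = ?\<Theta> and a = a, OF B s \<delta> I(2)])
    show "risk T N \<pi> est (?\<Theta> V) \<Gamma> \<le> (SUP \<theta>\<in>\<Psi>. risk T N \<pi> est \<theta> \<Gamma>)" if "V \<subseteq> B" for V
      by (rule SUP_upper[OF \<Psi>[OF that]])
  qed (use I(1) a in auto)
qed

text \<open>Models up to \<open>w\<close> move with the target. Later sources must keep their
  distance to a moving target while staying fixed, so one axis \<open>e\<close> is left out of the
  hypercube; this costs one dimension.\<close>

lemma minimax_risk_Psi_eq_bound:
  fixes \<Gamma> q :: "nat \<Rightarrow> real"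
  assumes "N \<ge> 1" and w: "w \<le> T" and \<Gamma>: "\<And>t. t \<le> w \<Longrightarrow> \<Gamma> w \<le> \<Gamma> t" "0 < \<Gamma> w"
    and q: "\<And>t. w < t \<Longrightarrow> t \<le> T \<Longrightarrow> real DIM('a) * \<Gamma> 0 / real N \<le> (q t)\<^sup>2"
  shows "ennreal ((real DIM('a) - 1) * (\<Gamma> w / real N * exp (- 1))) \<le>
    minimax_risk T N (Psi_eq T q :: (nat \<Rightarrow> 'a::euclidean_space) set) \<Gamma>"
proof -
  obtain e :: 'a where e: "e \<in> Basis" using nonempty_Basis by blast
  define B where "B = (Basis :: 'a set) - {e}"
  have B: "B \<subseteq> Basis" by (auto simp: B_def)
  have card: "real (card B) = real DIM('a) - 1"
    using e DIM_positive[where 'a = 'a] by (simp add: B_def card_Diff_singleton of_nat_diff)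
  \<comment> \<open>The largest half side that the two-point bound admits when the informative
    variances are at least \<open>\<Gamma> w\<close>.\<close>
  define \<delta> where "\<delta> = sqrt (\<Gamma> w / real N)"
  have \<delta>: "\<delta>\<^sup>2 = \<Gamma> w / real N" using \<Gamma> assms(1) by (simp add: \<delta>_def)
  \<comment> \<open>Sources beyond \<open>w\<close> do not depend on the hypercube vertex: the offset along \<open>e\<close>, orthogonal to the
    hypercube, completes the distance to every vertex to \<open>q t\<close>.\<close>
  define a where "a t = (if t = 0 then 0 else if t \<le> w then q t
    else sqrt ((q t)\<^sup>2 - real (card B) * \<delta>\<^sup>2)) *\<^sub>R e" for t
  have "restrict (\<lambda>t. a t + (if t \<in> {0..w} then hypercube_point \<delta> B V else 0)) {0..T} \<in> Psi_eq T q"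
    (is "?\<theta> \<in> _") if "V \<subseteq> B" for V
  proof -
    have "(norm (?\<theta> t - ?\<theta> 0))\<^sup>2 = (q t)\<^sup>2" if t: "t \<in> {1..T}" for t
    proof (cases "t \<le> w")
      case True
      then show ?thesis using t e by (simp add: a_def)
    next
      case False
      \<comment> \<open>The squared circumradius stays below the oracle threshold because
        \<open>\<Gamma> w \<le> \<Gamma> 0\<close>, so the square root in \<open>a\<close> is taken
        of a nonnegative number.\<close>
      have "real (card B) * \<delta>\<^sup>2 \<le> real DIM('a) * \<Gamma> 0 / real N"
        using \<Gamma>(1)[of 0] \<Gamma>(2) DIM_positive[where 'a = 'a]
        by (auto simp: \<delta> card times_divide_eq_right intro!: divide_right_mono mult_mono)
      also have "\<dots> \<le> (q t)\<^sup>2" using q[of t] False t by simp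
      finally have le: "real (card B) * \<delta>\<^sup>2 \<le> (q t)\<^sup>2" .
      have orth: "hypercube_point \<delta> B V \<bullet> e = 0"
        using inner_hypercube_point[OF B e] by (simp add: B_def)
      have "(norm (?\<theta> t - ?\<theta> 0))\<^sup>2 =
          (norm (sqrt ((q t)\<^sup>2 - real (card B) * \<delta>\<^sup>2) *\<^sub>R e - hypercube_point \<delta> B V))\<^sup>2"
        using t False by (simp add: a_def)
      also have "\<dots> = (norm (sqrt ((q t)\<^sup>2 - real (card B) * \<delta>\<^sup>2) *\<^sub>R e))\<^sup>2 + (norm (hypercube_point \<delta> B V))\<^sup>2"
        using orth unfolding power2_norm_eq_inner by (simp add: inner_diff_left inner_diff_right inner_commute)
      also have "\<dots> = (q t)\<^sup>2"
        using le e by (simp add: norm_hypercube_point[OF B] power_mult_distrib)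
      finally show ?thesis .
    qed
    then show ?thesis
      unfolding Psi_eq_def by (intro UN_I[of id]) (auto simp: permutes_id)
  qed
  then have "ennreal (real (card B) * (\<delta>\<^sup>2 * exp (- 1))) \<le> minimax_risk T N (Psi_eq T q :: (nat \<Rightarrow> 'a) set) \<Gamma>"
    using B \<Gamma> assms(1)
    by (intro minimax_risk_hypercube_bound[where s = "\<Gamma> w" and I = "{0..w}" and a = a])
       (auto simp: \<delta> a_def)
  then show ?thesis by (simp add: card \<delta>)
qed

text \<open>All sources sit at the origin and only the target moves, so the target's own variance
  \<open>\<Gamma> 0\<close> is the only one to enter. Every vertex is at distance
  \<open>\<bar>\<rho>\<bar>\<close> from the origin.\<close>

lemma minimax_risk_Psi_star_bound:
  fixes \<Gamma> :: "nat \<Rightarrow> real"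
  assumes "T \<ge> 1" "N \<ge> 1" "0 < \<Gamma> 0" "\<rho>\<^sup>2 \<le> real DIM('a) * \<Gamma> 0 / real N"
  shows "ennreal (\<rho>\<^sup>2 * exp (- 1)) \<le> minimax_risk T N (Psi_star T \<rho> :: (nat \<Rightarrow> 'a::euclidean_space) set) \<Gamma>"
proof -
  \<comment> \<open>Chosen so that the squared circumradius,
    \<open>DIM('a) * \<delta>\<^sup>2\<close>, equals \<open>\<rho>\<^sup>2\<close>.\<close>
  define \<delta> where "\<delta> = \<rho> / sqrt (real DIM('a))"
  have \<delta>: "\<delta>\<^sup>2 = \<rho>\<^sup>2 / real DIM('a)" by (simp add: \<delta>_def power_divide)
  have "restrict (\<lambda>t. 0 + (if t \<in> {0} then hypercube_point \<delta> Basis V else 0)) {0..T} \<in> Psi_star T \<rho>"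
    for V :: "'a set"
    unfolding Psi_star_def using assms(1) norm_hypercube_point[of "Basis :: 'a set" \<delta> V]
    by (intro UN_I[of id]) (auto simp: permutes_id \<delta> intro!: bexI[of _ 1])
  then have "ennreal (real DIM('a) * (\<delta>\<^sup>2 * exp (- 1))) \<le> minimax_risk T N (Psi_star T \<rho> :: (nat \<Rightarrow> 'a) set) \<Gamma>"
    using assms
    by (intro minimax_risk_hypercube_bound[where s = "\<Gamma> 0" and I = "{0}" and a = "\<lambda>_. 0"])
       (auto simp: \<delta> field_simps)
  then show ?thesis by (simp add: \<delta>)
qed

text \<open>Whatever the permutation, some source has radius \<open>q w\<close>, namely the preimage
  of \<open>w\<close>. The index must be that of a source, not 0.\<close>

lemma Psi_eq_subset_Psi_star:
  assumes "w \<in> {1..T}"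
  shows "Psi_eq T q \<subseteq> Psi_star T (q w)"
proof
  fix \<theta> :: "nat \<Rightarrow> 'a::euclidean_space"
  assume "\<theta> \<in> Psi_eq T q"
  then obtain \<zeta> where \<zeta>: "\<zeta> permutes {1..T}" "\<theta> \<in> {0..T} \<rightarrow>\<^sub>E UNIV"
    "\<forall>t\<in>{1..T}. (norm (\<theta> t - \<theta> 0))\<^sup>2 = (q (\<zeta> t))\<^sup>2"
    by (auto simp: Psi_eq_def)
  have "inv \<zeta> w \<in> {1..T}" "\<zeta> (inv \<zeta> w) = w"
    using assms permutes_in_image[OF permutes_inv[OF \<zeta>(1)]] permutes_inverses(1)[OF \<zeta>(1)] by auto
  then have "\<exists>t\<in>{1..T}. (norm (\<theta> t - \<theta> 0))\<^sup>2 = (q w)\<^sup>2"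
    using \<zeta>(3) by metis
  then show "\<theta> \<in> Psi_star T (q w)" using \<zeta> by (auto simp: Psi_star_def)
qed

lemma minimax_risk_mono:
  fixes \<Psi> \<Psi>' :: "(nat \<Rightarrow> 'a::euclidean_space) set"
  assumes "\<Psi> \<subseteq> \<Psi>'"
  shows "minimax_risk T N \<Psi> \<Gamma> \<le> minimax_risk T N \<Psi>' \<Gamma>"
  unfolding minimax_risk_def
proof (rule INF_mono)
  fix p :: "'a policy \<times> 'a estimator" assume "p \<in> cl_algorithms T N"
  then show "\<exists>p'\<in>cl_algorithms T N. (case p' of (\<pi>, est) \<Rightarrow> SUP \<theta>\<in>\<Psi>. risk T N \<pi> est \<theta> \<Gamma>) \<le>
      (case p of (\<pi>, est) \<Rightarrow> SUP \<theta>\<in>\<Psi>'. risk T N \<pi> est \<theta> \<Gamma>)"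
    using assms by (intro bexI[of _ p]) (auto split: prod.splits intro!: SUP_subset_mono)
qed

section \<open>The weak oracle index\<close>

text \<open>Under the orderings \<open>w\<close> is the largest index of the oracle set, so all
  later sources exceed the threshold. If the set is empty, \<open>w = 0\<close> and every source
  counts as later.\<close>

lemma weak_oracle_props:
  fixes d N T :: nat and q \<Gamma> :: "nat \<Rightarrow> real"
  assumes q: "\<forall>t\<in>{1..T}. 0 \<le> q t" "\<forall>t<T. (q t)\<^sup>2 \<le> (q (Suc t))\<^sup>2"
    and \<Gamma>: "\<forall>t<T. \<Gamma> (Suc t) \<le> \<Gamma> t"
  defines "w \<equiv> weak_oracle d T N q \<Gamma>"
  shows "w \<le> T" and "\<And>t. t \<le> w \<Longrightarrow> \<Gamma> w \<le> \<Gamma> t"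
    and "\<And>t. w < t \<Longrightarrow> t \<le> T \<Longrightarrow> real d * \<Gamma> 0 / real N < (q t)\<^sup>2"
    and "weak_oracle_set d T N q \<Gamma> \<noteq> {} \<Longrightarrow> w \<in> weak_oracle_set d T N q \<Gamma>"
    and "weak_oracle_set d T N q \<Gamma> = {} \<Longrightarrow> w = 0"
proof -
  let ?W = "weak_oracle_set d T N q \<Gamma>"
  have fin: "finite ?W" by (simp add: weak_oracle_set_def)
  have mono\<Gamma>: "\<Gamma> t \<le> \<Gamma> s" if "s \<le> t" "t \<le> T" for s t
    using that by (induction t rule: dec_induct) (auto intro: order_trans[OF \<Gamma>[rule_format]])
  \<comment> \<open>Monotone squares yield monotone radii where the radii are nonnegative, which is
    given from index 1 on.\<close>
  have monoq: "q s \<le> q t" if "1 \<le> s" "s \<le> t" "t \<le> T" for s t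
  proof (rule power2_le_imp_le)
    show "(q s)\<^sup>2 \<le> (q t)\<^sup>2"
      using that(2,3) by (induction t rule: dec_induct) (auto intro: order_trans[OF _ q(2)[rule_format]])
  qed (use that q(1) in auto)
  have Max: "w = Max ?W" if "?W \<noteq> {}"
    unfolding w_def using that monoq mono\<Gamma> by (rule weak_oracle_eq_Max)
  show mem: "w \<in> ?W" if "?W \<noteq> {}" using Max[OF that] Max_in[OF fin that] by simp
  show zero: "w = 0" if "?W = {}" using that by (simp add: w_def weak_oracle_def)
  show wT: "w \<le> T" using mem zero by (cases "?W = {}") (auto simp: weak_oracle_set_def)
  show "\<Gamma> w \<le> \<Gamma> t" if "t \<le> w" for t using mono\<Gamma>[OF that wT] .
  show "real d * \<Gamma> 0 / real N < (q t)\<^sup>2" if "w < t" "t \<le> T" for t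
  proof -
    have "t \<notin> ?W"
      using Max_ge[OF fin, of t] Max that by (cases "?W = {}") auto
    then show ?thesis using that by (auto simp: weak_oracle_set_def)
  qed
qed

theorem theorem4:
  assumes "DIM('a::euclidean_space) \<ge> 3"
  shows "\<exists>c\<ge>exp (- 5 :: real). \<forall>(T::nat) (N::nat) (q::nat \<Rightarrow> real) (\<sigma>::nat \<Rightarrow> real).
    T \<ge> 1 \<longrightarrow> N \<ge> 1 \<longrightarrow>
    q 0 = 0 \<longrightarrow> (\<forall>t\<in>{1..T}. 0 \<le> q t) \<longrightarrow>
    (\<forall>t<T. (q t)\<^sup>2 \<le> (q (Suc t))\<^sup>2) \<longrightarrow>
    (\<forall>t<T. (\<sigma> t)\<^sup>2 \<ge> (\<sigma> (Suc t))\<^sup>2) \<longrightarrow>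
    (let d = DIM('a);
         \<Gamma> = (\<lambda>t. (\<sigma> t)\<^sup>2);
         t_wo = weak_oracle d T N q \<Gamma>;
         L = (\<lambda>\<Psi> :: (nat \<Rightarrow> 'a) set. minimax_risk T N \<Psi> \<Gamma>)
     in (real d * \<Gamma> t_wo / real N \<ge> (q t_wo)\<^sup>2 \<longrightarrow>
           (weak_oracle_set d T N q \<Gamma> \<noteq> {} \<longrightarrow> L (Psi_star T (q t_wo)) \<ge> L (Psi_eq T q)) \<and>
           L (Psi_eq T q) \<ge> ennreal (c\<^sup>2 / 2 * (real d * \<Gamma> t_wo / real N))) \<and>
        (real d * \<Gamma> t_wo / real N < (q t_wo)\<^sup>2 \<longrightarrow>
           L (Psi_star T (q t_wo)) \<ge> ennreal (c\<^sup>2 / 8 * (q t_wo)\<^sup>2)))"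
proof (intro exI[of _ "exp (- 5)"] conjI order_refl allI impI)
  fix T N :: nat and q \<sigma> :: "nat \<Rightarrow> real"
  assume T: "T \<ge> 1" and N: "N \<ge> 1" and q: "q 0 = 0" "\<forall>t\<in>{1..T}. 0 \<le> q t"
    "\<forall>t<T. (q t)\<^sup>2 \<le> (q (Suc t))\<^sup>2" and \<sigma>: "\<forall>t<T. (\<sigma> t)\<^sup>2 \<ge> (\<sigma> (Suc t))\<^sup>2"
  define \<Gamma> where "\<Gamma> t = (\<sigma> t)\<^sup>2" for t
  define w where "w = weak_oracle DIM('a) T N q \<Gamma>"
  let ?W = "weak_oracle_set DIM('a) T N q \<Gamma>"
  have "\<forall>t<T. \<Gamma> (Suc t) \<le> \<Gamma> t" using \<sigma> by (simp add: \<Gamma>_def)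
  note w = weak_oracle_props[OF q(2,3) this, where d = "DIM('a)" and N = N, folded w_def]
  have e10: "(exp (- 5))\<^sup>2 \<le> (exp (- 1) :: real)"
    by (simp flip: exp_double)
  have nonneg: "\<Gamma> t \<ge> 0" for t by (simp add: \<Gamma>_def)
  have star: "minimax_risk T N (Psi_eq T q :: (nat \<Rightarrow> 'a) set) \<Gamma> \<le>
      minimax_risk T N (Psi_star T (q w) :: (nat \<Rightarrow> 'a) set) \<Gamma>"
    if "?W \<noteq> {}"
    using w(4)[OF that] by (intro minimax_risk_mono Psi_eq_subset_Psi_star) (auto simp: weak_oracle_set_def)
  have eq: "ennreal ((exp (- 5))\<^sup>2 / 2 * (real DIM('a) * \<Gamma> w / real N)) \<le>
      minimax_risk T N (Psi_eq T q :: (nat \<Rightarrow> 'a) set) \<Gamma>"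
  proof (cases "\<Gamma> w = 0")
    \<comment> \<open>Densities need \<open>\<Gamma> w > 0\<close>; if
      \<open>\<Gamma> w = 0\<close>, the claimed lower bound is 0.\<close>
    case False
    have "(exp (- 5))\<^sup>2 / 2 * (real DIM('a) * \<Gamma> w / real N) = (exp (- 5))\<^sup>2 * ((real DIM('a) / 2) * (\<Gamma> w / real N))"
      by simp
    \<comment> \<open>The dimension lost to the axis \<open>e\<close> is absorbed by
      \<open>d / 2 \<le> d - 1\<close>.\<close>
    also have "\<dots> \<le> exp (- 1) * ((real DIM('a) - 1) * (\<Gamma> w / real N))"
      using e10 assms nonneg[of w] by (intro mult_mono mult_right_mono) auto
    finally have "ennreal ((exp (- 5))\<^sup>2 / 2 * (real DIM('a) * \<Gamma> w / real N)) \<le>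
        ennreal ((real DIM('a) - 1) * (\<Gamma> w / real N * exp (- 1)))"
      by (intro ennreal_leI) (simp add: mult_ac)
    also have "\<dots> \<le> minimax_risk T N (Psi_eq T q :: (nat \<Rightarrow> 'a) set) \<Gamma>"
      using False nonneg[of w] N w by (intro minimax_risk_Psi_eq_bound) (auto intro: less_imp_le)
    finally show ?thesis .
  qed simp
  have star2: "ennreal ((exp (- 5))\<^sup>2 / 8 * (q w)\<^sup>2) \<le>
      minimax_risk T N (Psi_star T (q w) :: (nat \<Rightarrow> 'a) set) \<Gamma>"
    if lt: "real DIM('a) * \<Gamma> w / real N < (q w)\<^sup>2"
  proof -
    have qw: "0 < (q w)\<^sup>2"
      using lt nonneg[of w] by (meson divide_nonneg_nonneg le_less_trans mult_nonneg_nonneg of_nat_0_le_iff)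
    \<comment> \<open>A positive radius excludes \<open>w = 0\<close>, because
      \<open>q 0 = 0\<close>; hence \<open>w\<close> is a source below the oracle threshold.\<close>
    then have "?W \<noteq> {}" using w(5) q(1) by auto
    from w(4)[OF this] have le: "(q w)\<^sup>2 \<le> real DIM('a) * \<Gamma> 0 / real N"
      by (simp add: weak_oracle_set_def)
    \<comment> \<open>The threshold bounds a positive number, so the target is not
      noiseless.\<close>
    then have "\<Gamma> 0 \<noteq> 0" using qw by auto
    then have \<Gamma>0: "0 < \<Gamma> 0" using nonneg[of 0] by simp
    have "(exp (- 5))\<^sup>2 / 8 * (q w)\<^sup>2 \<le> (q w)\<^sup>2 * exp (- 1)"
    proof -
      have "(exp (- 5))\<^sup>2 / 8 \<le> (exp (- 1) :: real)"
        using e10 exp_ge_zero[of "- 1 :: real"] by linarith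
      from mult_left_mono[OF this, of "(q w)\<^sup>2"] show ?thesis by (simp add: mult.commute)
    qed
    then have "ennreal ((exp (- 5))\<^sup>2 / 8 * (q w)\<^sup>2) \<le> ennreal ((q w)\<^sup>2 * exp (- 1))"
      by (rule ennreal_leI)
    also have "\<dots> \<le> minimax_risk T N (Psi_star T (q w) :: (nat \<Rightarrow> 'a) set) \<Gamma>"
      using T N \<Gamma>0 le by (rule minimax_risk_Psi_star_bound)
    finally show ?thesis .
  qed
  show "let d = DIM('a);
         \<Gamma> = (\<lambda>t. (\<sigma> t)\<^sup>2);
         t_wo = weak_oracle d T N q \<Gamma>;
         L = (\<lambda>\<Psi> :: (nat \<Rightarrow> 'a) set. minimax_risk T N \<Psi> \<Gamma>)
     in (real d * \<Gamma> t_wo / real N \<ge> (q t_wo)\<^sup>2 \<longrightarrow>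
           (weak_oracle_set d T N q \<Gamma> \<noteq> {} \<longrightarrow> L (Psi_star T (q t_wo)) \<ge> L (Psi_eq T q)) \<and>
           L (Psi_eq T q) \<ge> ennreal ((exp (- 5))\<^sup>2 / 2 * (real d * \<Gamma> t_wo / real N))) \<and>
        (real d * \<Gamma> t_wo / real N < (q t_wo)\<^sup>2 \<longrightarrow>
           L (Psi_star T (q t_wo)) \<ge> ennreal ((exp (- 5))\<^sup>2 / 8 * (q t_wo)\<^sup>2))"
    unfolding Let_def \<Gamma>_def[abs_def, symmetric] w_def[symmetric]
    using star eq star2 by blast
qed

end
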